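(* The category $\mathcal{VA}_{\mathcal{L}}$ of $\mathcal{L}$-$\mathcal{VL}$-algebras is dually equivalent to the category $PBS_{\mathcal{L}}$, via the functors $F:PBS_{\mathcal{L}}\to\mathcal{VA}_{\mathcal{L}}$ and $G:\mathcal{VA}_{\mathcal{L}}\to PBS_{\mathcal{L}}$, with natural isomorphisms $\beta^{\mathcal{A}}:\mathcal{A}\to F(G(\mathcal{A}))$, $\beta^{\mathcal{A}}(a)(\phi)=\phi(a)$, and $\zeta_{(\mathcal{S},\alpha_{\mathcal{S}})}:(\mathcal{S},\alpha_{\mathcal{S}})\to G(F(\mathcal{S},\alpha_{\mathcal{S}}))$, $\zeta_{(\mathcal{S},\alpha_{\mathcal{S}})}(s)(\psi)=\psi(s)$ (the latter being a bi-homeomorphism, i.e. a bijection which is pairwise continuous with pairwise continuous inverse).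
   Context: $\mathcal{L}$ is a finite bounded distributive lattice, hence a Heyting algebra. An $\mathcal{L}$-$\mathcal{VL}$-algebra is a structure $(\mathcal{A},\wedge,\vee,\to,(T_\ell)_{\ell\in\mathcal{L}},0,1)$, with unary operations $T_\ell$, such that for all $\ell,\ell_1,\ell_2\in\mathcal{L}$ and $a,b\in\mathcal{A}$: (i) $(\mathcal{A},\wedge,\vee,\to,0,1)$ is a Heyting algebra; (ii) $T_{\ell_1}(a)\wedge T_{\ell_2}(b)\le T_{\ell_1\to\ell_2}(a\to b)\wedge T_{\ell_1\wedge\ell_2}(a\wedge b)\wedge T_{\ell_1\vee\ell_2}(a\vee b)$ and $T_{\ell_2}(a)\le T_{T_{\ell_1}(\ell_2)}(T_{\ell_1}(a))$; (iii) $T_0(0)=1$, $T_\ell(0)=0$ for $\ell\neq0$, $T_1(1)=1$, $T_\ell(1)=0$ for $\ell\ne1$; (iv) $\bigvee_{\ell\in\mathcal{L}}T_\ell(a)=1$, $T_\ell(a)\vee(T_\ell(a)\to0)=1$, and $T_{\ell_1}(a)\wedge T_{\ell_2}(a)=0$ for $\ell_1\ne\ell_2$; (v) $T_1(T_\ell(a))=T_\ell(a)$, $T_0(T_\ell(a))=T_\ell(a)\to0$, $T_{\ell_2}(T_{\ell_1}(a))=0$ for $\ell_2\neq0,1$; (vi) $T_1(a)\le a$, $T_1(a\wedge b)=T_1(a)\wedge T_1(b)$; (vii) $\bigwedge_{\ell\in\mathcal{L}}(T_\ell(a)\leftrightarrow T_\ell(b))\le(a\leftrightarrow b)$. $\mathcal{L}$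 itself is regarded as an $\mathcal{L}$-$\mathcal{VL}$-algebra with its Heyting operations and $T_\ell(x)=1$ if $x=\ell$, $T_\ell(x)=0$ otherwise; $\Sigma_{\mathcal{L}}$ denotes the set of subalgebras of $\mathcal{L}$. $\mathcal{VA}_{\mathcal{L}}$ is the category of $\mathcal{L}$-$\mathcal{VL}$-algebras and homomorphisms. A bitopological space $(S,\tau_1,\tau_2)$ is pairwise Boolean if it is pairwise Hausdorff (distinct $s_1,s_2$ have disjoint neighbourhoods $O_1\in\tau_1\ni s_1$, $O_2\in\tau_2\ni s_2$), pairwise zero-dimensional ($\tau_1$-open $\tau_2$-closed sets form a basis of $\tau_1$ and $\tau_2$-open $\tau_1$-closed sets form a basis of $\tau_2$) and pairwise compact (every cover by sets of $\tau_1\cup\tau_2$ has a finite subcover). A subset is pairwise closed if it is closed in both topologies; $\Omega_{\mathcal{B}}$ is the set of pairwise closed subsets of $\mathcal{B}$. A map is pairwise continuous if it is continuous for the first topologies and for the second topologies. The category $PBS_{\mathcal{L}}$: objects are pairs $(\mathcal{B},\alpha_{\mathcal{B}})$ with $\mathcal{B}$ a pairwise Boolean space and $\alpha_{\mathcal{B}}:\Sigma_{\mathcal{L}}\to\Omega_{\mathcal{B}}$ such that $\alpha_{\mathcal{B}}(\mathcal{L})=\mathcal{B}$ and $\alpha_{\mathcal{B}}(\mathcal{L}_2\cap\mathcal{L}_3)=\alpha_{\mathcal{B}}(\mathcal{L}_2)\cap\alpha_{\mathcal{B}}(\mathcal{L}_3)$; morphisms $f:(\mathcal{B},\alpha_{\mathcal{B}})\to(\mathcal{B}',\alpha_{\mathcal{B}'})$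 are pairwise continuous maps with $f(\alpha_{\mathcal{B}}(\mathcal{L}'))\subseteq\alpha_{\mathcal{B}'}(\mathcal{L}')$ for all $\mathcal{L}'\in\Sigma_{\mathcal{L}}$. $(\mathcal{L},\alpha_{\mathcal{L}})$ is $\mathcal{L}$ with the discrete topology as both topologies and $\alpha_{\mathcal{L}}(\mathcal{L}')=\mathcal{L}'$. The functor $F$: $F(\mathcal{B},\alpha_{\mathcal{B}})=\mathrm{Hom}_{PBS_{\mathcal{L}}}((\mathcal{B},\alpha_{\mathcal{B}}),(\mathcal{L},\alpha_{\mathcal{L}}))$ with $\vee,\wedge,\to,T_p$ defined pointwise and $0,1$ constant; $F(\phi)(\eta)=\eta\circ\phi$. The functor $G$: $G(\mathcal{A})=(\mathrm{Hom}_{\mathcal{VA}_{\mathcal{L}}}(\mathcal{A},\mathcal{L}),\sigma_1,\sigma_2,\alpha_{\mathcal{A}})$, where $\sigma_1$ has basis $\{\langle a\rangle:a\in\mathcal{A}\}$ with $\langle a\rangle=\{v:v(a)=1\}$, $\sigma_2$ has basis $\{\langle a\rangle^c:a\in\mathcal{A}\}$, and $\alpha_{\mathcal{A}}(\mathcal{L}')=\mathrm{Hom}_{\mathcal{VA}_{\mathcal{L}}}(\mathcal{A},\mathcal{L}')$; $G(g)(\mu)=\mu\circ g$.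
   Formalization: The lattice L is assumed nontrivial (0 ≠ 1); for one-element L every algebra is trivial while PBS_L contains spaces with several points, and the prescribed basis of σ_2 does not cover Hom(A, L), so the claim fails there. *)

theory Defs
  imports "HOL-Analysis.Analysis"
begin

definition himpL :: "'l::finite_distrib_lattice \<Rightarrow> 'l \<Rightarrow> 'l" where
  "himpL x y = Sup {z. inf z x \<le> y}"

definition TL :: "'l::finite_distrib_lattice \<Rightarrow> 'l \<Rightarrow> 'l" where
  "TL p x = (if x = p then top else bot)"

record ('l, 'a) vl_struct =
  vcarrier :: "'a set"
  vmeet :: "'a \<Rightarrow> 'a \<Rightarrow> 'a"
  vjoin :: "'a \<Rightarrow> 'a \<Rightarrow> 'a"
  vimp  :: "'a \<Rightarrow> 'a \<Rightarrow> 'a"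
  vT    :: "'l \<Rightarrow> 'a \<Rightarrow> 'a"
  vzero :: "'a"
  vone  :: "'a"

definition vle :: "('l, 'a) vl_struct \<Rightarrow> 'a \<Rightarrow> 'a \<Rightarrow> bool" where
  "vle A x y \<longleftrightarrow> vmeet A x y = x"

definition viff :: "('l, 'a) vl_struct \<Rightarrow> 'a \<Rightarrow> 'a \<Rightarrow> 'a" where
  "viff A x y = vmeet A (vimp A x y) (vimp A y x)"

definition lvals :: "'l::finite list" where
  "lvals = (SOME xs. distinct xs \<and> set xs = UNIV)"

definition vBigJoin :: "('l::finite, 'a) vl_struct \<Rightarrow> ('l \<Rightarrow> 'a) \<Rightarrow> 'a" where
  "vBigJoin A f = foldr (vjoin A) (map f lvals) (vzero A)"

definition vBigMeet :: "('l::finite, 'a) vl_struct \<Rightarrow> ('l \<Rightarrow> 'a) \<Rightarrow> 'a" where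
  "vBigMeet A f = foldr (vmeet A) (map f lvals) (vone A)"

definition heyting_alg :: "('l, 'a) vl_struct \<Rightarrow> bool" where
  "heyting_alg A \<longleftrightarrow>
     vzero A \<in> vcarrier A \<and> vone A \<in> vcarrier A \<and>
     (\<forall>x\<in>vcarrier A. \<forall>y\<in>vcarrier A.
        vmeet A x y \<in> vcarrier A \<and> vjoin A x y \<in> vcarrier A \<and> vimp A x y \<in> vcarrier A) \<and>
     (\<forall>x\<in>vcarrier A. \<forall>y\<in>vcarrier A.
        vmeet A x y = vmeet A y x \<and> vjoin A x y = vjoin A y x \<and>
        vmeet A x (vjoin A x y) = x \<and> vjoin A x (vmeet A x y) = x) \<and>
     (\<forall>x\<in>vcarrier A. \<forall>y\<in>vcarrier A. \<forall>z\<in>vcarrier A.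
        vmeet A x (vmeet A y z) = vmeet A (vmeet A x y) z \<and>
        vjoin A x (vjoin A y z) = vjoin A (vjoin A x y) z) \<and>
     (\<forall>x\<in>vcarrier A. vmeet A (vzero A) x = vzero A \<and> vmeet A (vone A) x = x) \<and>
     (\<forall>x\<in>vcarrier A. \<forall>y\<in>vcarrier A. \<forall>z\<in>vcarrier A.
        vle A (vmeet A z x) y \<longleftrightarrow> vle A z (vimp A x y))"

definition vl_alg :: "('l::finite_distrib_lattice, 'a) vl_struct \<Rightarrow> bool" where
  "vl_alg A \<longleftrightarrow>
     heyting_alg A \<and>
     (\<forall>l. \<forall>x\<in>vcarrier A. vT A l x \<in> vcarrier A) \<and>
     \<comment> \<open>(ii)\<close>
     (\<forall>l1 l2. \<forall>a\<in>vcarrier A. \<forall>b\<in>vcarrier A.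
        vle A (vmeet A (vT A l1 a) (vT A l2 b))
              (vmeet A (vT A (himpL l1 l2) (vimp A a b))
                 (vmeet A (vT A (inf l1 l2) (vmeet A a b)) (vT A (sup l1 l2) (vjoin A a b))))
      \<and> vle A (vT A l2 a) (vT A (TL l1 l2) (vT A l1 a))) \<and>
     \<comment> \<open>(iii)\<close>
     vT A bot (vzero A) = vone A \<and> (\<forall>l. l \<noteq> bot \<longrightarrow> vT A l (vzero A) = vzero A) \<and>
     vT A top (vone A) = vone A \<and> (\<forall>l. l \<noteq> top \<longrightarrow> vT A l (vone A) = vzero A) \<and>
     \<comment> \<open>(iv)\<close>
     (\<forall>a\<in>vcarrier A.
        vBigJoin A (\<lambda>l. vT A l a) = vone A \<and>
        (\<forall>l. vjoin A (vT A l a) (vimp A (vT A l a) (vzero A)) = vone A) \<and>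
        (\<forall>l1 l2. l1 \<noteq> l2 \<longrightarrow> vmeet A (vT A l1 a) (vT A l2 a) = vzero A)) \<and>
     \<comment> \<open>(v)\<close>
     (\<forall>a\<in>vcarrier A. \<forall>l.
        vT A top (vT A l a) = vT A l a \<and>
        vT A bot (vT A l a) = vimp A (vT A l a) (vzero A) \<and>
        (\<forall>l2. l2 \<noteq> bot \<and> l2 \<noteq> top \<longrightarrow> vT A l2 (vT A l a) = vzero A)) \<and>
     \<comment> \<open>(vi)\<close>
     (\<forall>a\<in>vcarrier A. \<forall>b\<in>vcarrier A.
        vle A (vT A top a) a \<and> vT A top (vmeet A a b) = vmeet A (vT A top a) (vT A top b)) \<and>
     \<comment> \<open>(vii)\<close>
     (\<forall>a\<in>vcarrier A. \<forall>b\<in>vcarrier A.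
        vle A (vBigMeet A (\<lambda>l. viff A (vT A l a) (vT A l b))) (viff A a b))"

definition vhom :: "('l, 'a) vl_struct \<Rightarrow> ('l, 'b) vl_struct \<Rightarrow> ('a \<Rightarrow> 'b) set" where
  "vhom A B = {f. f \<in> vcarrier A \<rightarrow>\<^sub>E vcarrier B \<and>
     (\<forall>x\<in>vcarrier A. \<forall>y\<in>vcarrier A.
        f (vmeet A x y) = vmeet B (f x) (f y) \<and> f (vjoin A x y) = vjoin B (f x) (f y) \<and>
        f (vimp A x y) = vimp B (f x) (f y)) \<and>
     (\<forall>l. \<forall>x\<in>vcarrier A. f (vT A l x) = vT B l (f x)) \<and>
     f (vzero A) = vzero B \<and> f (vone A) = vone B}"

definition L_alg :: "('l::finite_distrib_lattice, 'l) vl_struct" where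
  "L_alg = \<lparr>vcarrier = UNIV, vmeet = inf, vjoin = sup, vimp = himpL, vT = TL,
            vzero = bot, vone = top\<rparr>"

definition SigmaL :: "'l::finite_distrib_lattice set set" where
  "SigmaL = {S. bot \<in> S \<and> top \<in> S \<and>
     (\<forall>x\<in>S. \<forall>y\<in>S. inf x y \<in> S \<and> sup x y \<in> S \<and> himpL x y \<in> S) \<and>
     (\<forall>p. \<forall>x\<in>S. TL p x \<in> S)}"

definition pairwise_hausdorff :: "'b topology \<Rightarrow> 'b topology \<Rightarrow> bool" where
  "pairwise_hausdorff t1 t2 \<longleftrightarrow>
     (\<forall>s1\<in>topspace t1. \<forall>s2\<in>topspace t1. s1 \<noteq> s2 \<longrightarrow>
        (\<exists>O1 O2. openin t1 O1 \<and> openin t2 O2 \<and> s1 \<in> O1 \<and> s2 \<in> O2 \<and> O1 \<inter> O2 = {}))"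

definition pairwise_zero_dim :: "'b topology \<Rightarrow> 'b topology \<Rightarrow> bool" where
  "pairwise_zero_dim t1 t2 \<longleftrightarrow>
     (\<forall>U x. openin t1 U \<and> x \<in> U \<longrightarrow>
        (\<exists>V. openin t1 V \<and> closedin t2 V \<and> x \<in> V \<and> V \<subseteq> U)) \<and>
     (\<forall>U x. openin t2 U \<and> x \<in> U \<longrightarrow>
        (\<exists>V. openin t2 V \<and> closedin t1 V \<and> x \<in> V \<and> V \<subseteq> U))"

definition pairwise_compact :: "'b topology \<Rightarrow> 'b topology \<Rightarrow> bool" where
  "pairwise_compact t1 t2 \<longleftrightarrow>
     (\<forall>\<U>. (\<forall>U\<in>\<U>. openin t1 U \<or> openin t2 U) \<and> topspace t1 \<subseteq> \<Union>\<U> \<longrightarrow>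
        (\<exists>\<V>\<subseteq>\<U>. finite \<V> \<and> topspace t1 \<subseteq> \<Union>\<V>))"

definition pairwise_boolean :: "'b topology \<Rightarrow> 'b topology \<Rightarrow> bool" where
  "pairwise_boolean t1 t2 \<longleftrightarrow>
     topspace t1 = topspace t2 \<and>
     pairwise_hausdorff t1 t2 \<and> pairwise_zero_dim t1 t2 \<and> pairwise_compact t1 t2"

definition pairwise_closed :: "'b topology \<Rightarrow> 'b topology \<Rightarrow> 'b set \<Rightarrow> bool" where
  "pairwise_closed t1 t2 X \<longleftrightarrow> closedin t1 X \<and> closedin t2 X"

record ('l, 'b) pbs =
  ptop1 :: "'b topology"
  ptop2 :: "'b topology"
  palpha :: "'l set \<Rightarrow> 'b set"

abbreviation pspace :: "('l, 'b) pbs \<Rightarrow> 'b set" where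
  "pspace B \<equiv> topspace (ptop1 B)"

definition pbs_obj :: "('l::finite_distrib_lattice, 'b) pbs \<Rightarrow> bool" where
  "pbs_obj B \<longleftrightarrow>
     pairwise_boolean (ptop1 B) (ptop2 B) \<and>
     (\<forall>L'\<in>SigmaL. pairwise_closed (ptop1 B) (ptop2 B) (palpha B L')) \<and>
     palpha B UNIV = pspace B \<and>
     (\<forall>L2\<in>SigmaL. \<forall>L3\<in>SigmaL. palpha B (L2 \<inter> L3) = palpha B L2 \<inter> palpha B L3)"

definition pbs_hom :: "('l::finite_distrib_lattice, 'b) pbs \<Rightarrow> ('l, 'c) pbs \<Rightarrow> ('b \<Rightarrow> 'c) set" where
  "pbs_hom B C = {f. f \<in> pspace B \<rightarrow>\<^sub>E pspace C \<and>
     continuous_map (ptop1 B) (ptop1 C) f \<and> continuous_map (ptop2 B) (ptop2 C) f \<and>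
     (\<forall>L'\<in>SigmaL. f ` palpha B L' \<subseteq> palpha C L')}"

definition L_pbs :: "('l::finite_distrib_lattice, 'l) pbs" where
  "L_pbs = \<lparr>ptop1 = discrete_topology UNIV, ptop2 = discrete_topology UNIV, palpha = id\<rparr>"

definition Fobj :: "('l::finite_distrib_lattice, 'b) pbs \<Rightarrow> ('l, 'b \<Rightarrow> 'l) vl_struct" where
  "Fobj B = \<lparr>vcarrier = pbs_hom B L_pbs,
     vmeet = (\<lambda>f g. \<lambda>s\<in>pspace B. inf (f s) (g s)),
     vjoin = (\<lambda>f g. \<lambda>s\<in>pspace B. sup (f s) (g s)),
     vimp = (\<lambda>f g. \<lambda>s\<in>pspace B. himpL (f s) (g s)),
     vT = (\<lambda>p f. \<lambda>s\<in>pspace B. TL p (f s)),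
     vzero = (\<lambda>s\<in>pspace B. bot),
     vone = (\<lambda>s\<in>pspace B. top)\<rparr>"

definition Fmor :: "('l::finite_distrib_lattice, 'b) pbs \<Rightarrow> ('l, 'c) pbs \<Rightarrow> ('b \<Rightarrow> 'c)
                     \<Rightarrow> ('c \<Rightarrow> 'l) \<Rightarrow> ('b \<Rightarrow> 'l)" where
  "Fmor B C \<phi> = (\<lambda>\<eta>\<in>vcarrier (Fobj C). \<lambda>s\<in>pspace B. \<eta> (\<phi> s))"

definition basic_open :: "('l::finite_distrib_lattice, 'a) vl_struct \<Rightarrow> 'a \<Rightarrow> ('a \<Rightarrow> 'l) set" where
  "basic_open A a = {v \<in> vhom A L_alg. v a = top}"

definition Gobj :: "('l::finite_distrib_lattice, 'a) vl_struct \<Rightarrow> ('l, 'a \<Rightarrow> 'l) pbs" where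
  "Gobj A = \<lparr>ptop1 = topology_generated_by ((\<lambda>a. basic_open A a) ` vcarrier A),
     ptop2 = topology_generated_by ((\<lambda>a. vhom A L_alg - basic_open A a) ` vcarrier A),
     palpha = (\<lambda>L'. {v \<in> vhom A L_alg. v ` vcarrier A \<subseteq> L'})\<rparr>"

definition Gmor :: "('l::finite_distrib_lattice, 'a) vl_struct \<Rightarrow> ('l, 'c) vl_struct \<Rightarrow> ('a \<Rightarrow> 'c)
                     \<Rightarrow> ('c \<Rightarrow> 'l) \<Rightarrow> ('a \<Rightarrow> 'l)" where
  "Gmor A C g = (\<lambda>\<mu>\<in>vhom C L_alg. \<lambda>a\<in>vcarrier A. \<mu> (g a))"

definition beta :: "('l::finite_distrib_lattice, 'a) vl_struct \<Rightarrow> 'a \<Rightarrow> (('a \<Rightarrow> 'l) \<Rightarrow> 'l)" where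
  "beta A = (\<lambda>a\<in>vcarrier A. \<lambda>\<phi>\<in>vhom A L_alg. \<phi> a)"

definition zeta :: "('l::finite_distrib_lattice, 'b) pbs \<Rightarrow> 'b \<Rightarrow> (('b \<Rightarrow> 'l) \<Rightarrow> 'l)" where
  "zeta B = (\<lambda>s\<in>pspace B. \<lambda>\<psi>\<in>pbs_hom B L_pbs. \<psi> s)"

end

theory Submission
  imports Defs
begin

text \<open>
  The two topologies of a pairwise Boolean space coincide, so such a space is a Stone space, and
  \<open>G(A)\<close> is a closed subspace of \<open>L\<^sup>A\<close>. A prime filter \<open>P\<close> of \<open>A\<close> gives the homomorphism sending
  \<open>a\<close> to the unique \<open>l\<close> with \<open>T\<^sub>l a \<in> P\<close>; by the prime filter theorem and axiom (vii) these
  homomorphisms separate points, so \<open>\<beta>\<close> is injective. A morphism \<open>f\<close> on \<open>G(A)\<close> satisfies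
  \<open>f v \<in> v(A)\<close>, hence agrees near \<open>v\<close> with the evaluation at an element of \<open>A\<close>; by compactness
  finitely many such elements suffice, and they are glued with the Boolean elements \<open>T\<^sub>1 b\<close>, so \<open>\<beta>\<close>
  is surjective. On the other side, the morphisms into \<open>L\<close> take at \<open>s\<close> exactly the values in the
  least subalgebra \<open>L'\<close> with \<open>s \<in> \<alpha>(L')\<close>, even when required to vanish on a closed set avoiding
  \<open>s\<close>; hence \<open>\<zeta>\<close> is injective and reflects \<open>\<alpha>\<close>. Its image is compact, and dense because
  \<open>T\<^sub>1 \<psi> = 0\<close> when \<open>\<psi>\<close> omits the value \<open>1\<close>.
\<close>

section \<open>The lattice \<open>L\<close>\<close>

lemma le_himpL_iff: "z \<le> himpL x y \<longleftrightarrow> inf z x \<le> y"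
proof
  show "z \<le> himpL x y" if "inf z x \<le> y"
    unfolding himpL_def using that by (simp add: Sup_upper)
  have "inf x (himpL x y) \<le> y"
    unfolding himpL_def by (auto simp: inf_Sup inf_commute intro: SUP_least)
  moreover assume "z \<le> himpL x y"
  ultimately show "inf z x \<le> y"
    by (metis inf.commute inf_mono order_refl order_trans)
qed

lemma himpL_eq_top_iff: "himpL x y = top \<longleftrightarrow> x \<le> y"
  using le_himpL_iff[of top x y] by (simp add: top_unique)

lemma himpL_refl [simp]: "himpL x x = top"
  by (simp add: himpL_eq_top_iff)

lemma himpL_top_left [simp]: "himpL top y = y"
  by (metis le_himpL_iff inf_top_right order_antisym order_refl)

lemma TL_eq_top_iff:
  assumes "(bot::'l::finite_distrib_lattice) \<noteq> top"
  shows "TL l x = top \<longleftrightarrow> x = (l::'l)"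
  using assms by (auto simp: TL_def)

lemma SigmaL_Inter: "\<S> \<subseteq> SigmaL \<Longrightarrow> \<Inter>\<S> \<in> SigmaL"
  by (auto simp: SigmaL_def)

lemma SigmaLD:
  assumes "S \<in> SigmaL"
  shows "bot \<in> S" "top \<in> S" "TL p x \<in> S"
    "x \<in> S \<Longrightarrow> y \<in> S \<Longrightarrow> inf x y \<in> S"
    "x \<in> S \<Longrightarrow> y \<in> S \<Longrightarrow> sup x y \<in> S"
    "x \<in> S \<Longrightarrow> y \<in> S \<Longrightarrow> himpL x y \<in> S"
  using assms by (auto simp: SigmaL_def TL_def)

lemma set_lvals: "set (lvals :: 'l::finite list) = UNIV"
proof -
  obtain xs :: "'l list" where "distinct xs \<and> set xs = UNIV"
    using finite_distinct_list[of "UNIV :: 'l set"] by auto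
  then show ?thesis
    unfolding lvals_def by (rule someI2) simp
qed

section \<open>Pairwise Boolean spaces are Stone spaces\<close>

definition stone_space :: "'b topology \<Rightarrow> bool" where
  "stone_space X \<longleftrightarrow> compact_space X \<and> Hausdorff_space X \<and> X dim_le 0"

lemma dim_le_0_iff_ex_clopen:
  "X dim_le 0 \<longleftrightarrow>
    (\<forall>U x. openin X U \<and> x \<in> U \<longrightarrow> (\<exists>K. openin X K \<and> closedin X K \<and> x \<in> K \<and> K \<subseteq> U))"
  unfolding dimension_le_0_neighbourhood_base_of_clopen
  by (subst open_neighbourhood_base_of) (auto simp: conj_ac)

lemma stone_space_clopen_avoiding:
  assumes "stone_space X" "closedin X C" "x \<in> topspace X" "x \<notin> C"
  obtains K where "openin X K" "closedin X K" "x \<in> K" "K \<inter> C = {}"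
proof -
  have "openin X (topspace X - C)" "x \<in> topspace X - C"
    using assms by auto
  then obtain K where "openin X K" "closedin X K" "x \<in> K" "K \<subseteq> topspace X - C"
    using assms(1) unfolding stone_space_def dim_le_0_iff_ex_clopen by blast
  then show thesis
    using that by blast
qed

lemma pairwise_hausdorff_sym:
  "topspace t1 = topspace t2 \<Longrightarrow> pairwise_hausdorff t1 t2 \<Longrightarrow> pairwise_hausdorff t2 t1"
  unfolding pairwise_hausdorff_def by (metis Int_commute)

lemma pairwise_hausdorff_compactin_separation:
  assumes hausdorff: "pairwise_hausdorff t1 t2" and C: "compactin t1 C"
    and x: "x \<in> topspace t1" "x \<in> topspace t2" "x \<notin> C"
  shows "\<exists>V. openin t2 V \<and> x \<in> V \<and> V \<inter> C = {}"
proof -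
  define \<W> where "\<W> = {W. openin t1 W \<and> (\<exists>V. openin t2 V \<and> x \<in> V \<and> W \<inter> V = {})}"
  have "C \<subseteq> \<Union>\<W>"
  proof
    fix y assume "y \<in> C"
    then have "y \<in> topspace t1" "y \<noteq> x"
      using x(3) compactin_subset_topspace[OF C] by auto
    then obtain W V where "openin t1 W" "openin t2 V" "y \<in> W" "x \<in> V" "W \<inter> V = {}"
      using hausdorff x(1) unfolding pairwise_hausdorff_def by metis
    then show "y \<in> \<Union>\<W>"
      unfolding \<W>_def by blast
  qed
  moreover have "\<forall>W\<in>\<W>. openin t1 W"
    by (simp add: \<W>_def)
  ultimately obtain \<V> where \<V>: "finite \<V>" "\<V> \<subseteq> \<W>" "C \<subseteq> \<Union>\<V>"
    using C unfolding compactin_def by meson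
  then have "\<forall>W\<in>\<V>. \<exists>V. openin t2 V \<and> x \<in> V \<and> W \<inter> V = {}"
    by (auto simp: \<W>_def)
  then obtain N where N: "\<And>W. W \<in> \<V> \<Longrightarrow> openin t2 (N W) \<and> x \<in> N W \<and> W \<inter> N W = {}"
    by metis
  have "openin t2 (topspace t2 \<inter> \<Inter>(N ` \<V>))"
    using \<V>(1) N by (cases "\<V> = {}") (auto intro!: openin_Int openin_Inter)
  moreover have "x \<in> topspace t2 \<inter> \<Inter>(N ` \<V>)" "(topspace t2 \<inter> \<Inter>(N ` \<V>)) \<inter> C = {}"
    using x(2) N \<V>(3) by fastforce+
  ultimately show ?thesis
    by blast
qed

lemma pairwise_hausdorff_compactin_imp_closedin:
  assumes space_eq: "topspace t1 = topspace t2" and hausdorff: "pairwise_hausdorff t1 t2"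
    and C: "compactin t1 C"
  shows "closedin t2 C"
proof -
  have "\<exists>V. openin t2 V \<and> x \<in> V \<and> V \<subseteq> topspace t2 - C" if "x \<in> topspace t2 - C" for x
    using pairwise_hausdorff_compactin_separation[OF hausdorff C, of x] that space_eq openin_subset
    by fastforce
  then have "openin t2 (topspace t2 - C)"
    by (subst openin_subopen) blast
  then show ?thesis
    using compactin_subset_topspace[OF C] space_eq by (simp add: closedin_def)
qed

lemma pairwise_hausdorff_compact_imp_eq:
  assumes space_eq: "topspace t1 = topspace t2" and hausdorff: "pairwise_hausdorff t1 t2"
    and compact: "compact_space t1" "compact_space t2"
  shows "t1 = t2"
proof -
  have "closedin t2 C" if "closedin t1 C" for C
    using pairwise_hausdorff_compactin_imp_closedin[OF space_eq hausdorff]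
      closedin_compact_space[OF compact(1) that] .
  moreover have "closedin t1 C" if "closedin t2 C" for C
    using pairwise_hausdorff_compactin_imp_closedin[OF space_eq[symmetric]
        pairwise_hausdorff_sym[OF space_eq hausdorff]] closedin_compact_space[OF compact(2) that] .
  ultimately show ?thesis
    unfolding topology_eq by (metis openin_closedin_eq space_eq)
qed

lemma pairwise_compact_imp_compact_space:
  assumes "pairwise_compact t1 t2" "topspace t1 = topspace t2"
  shows "compact_space t1" "compact_space t2"
proof -
  have "\<exists>\<V>\<subseteq>\<U>. finite \<V> \<and> topspace t1 \<subseteq> \<Union>\<V>"
    if "\<forall>U\<in>\<U>. openin t1 U \<or> openin t2 U" "topspace t1 \<subseteq> \<Union>\<U>" for \<U>
    using assms(1) that unfolding pairwise_compact_def by simp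
  then show "compact_space t1" "compact_space t2"
    unfolding compact_space_alt assms(2)[symmetric] by (simp_all add: conj_ac)
qed

lemma pairwise_boolean_iff: "pairwise_boolean t1 t2 \<longleftrightarrow> t1 = t2 \<and> stone_space t1"
proof -
  have "t1 = t2" if "pairwise_boolean t1 t2"
    using that pairwise_hausdorff_compact_imp_eq pairwise_compact_imp_compact_space
    unfolding pairwise_boolean_def by blast
  moreover have "pairwise_compact t t \<longleftrightarrow> compact_space t" for t :: "'a topology"
    by (simp add: pairwise_compact_def compact_space_alt conj_ac)
  moreover have "pairwise_hausdorff t t \<longleftrightarrow> Hausdorff_space t" for t :: "'a topology"
    by (auto simp: pairwise_hausdorff_def Hausdorff_space_def disjnt_def)
  ultimately show ?thesis
    by (auto simp: pairwise_boolean_def stone_space_def pairwise_zero_dim_def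
        dim_le_0_iff_ex_clopen)
qed

section \<open>Continuous maps into discrete spaces\<close>

lemma continuous_map_discrete_compose2:
  assumes "continuous_map X (discrete_topology UNIV) f"
    and "continuous_map X (discrete_topology UNIV) g"
  shows "continuous_map X (discrete_topology UNIV) (\<lambda>x. h (f x) (g x))"
proof -
  have "continuous_map X (discrete_topology UNIV) (\<lambda>x. (f x, g x))"
    using continuous_map_pairedI[OF assms] by (simp flip: prod_topology_discrete_topology)
  then have "continuous_map X (discrete_topology UNIV) ((\<lambda>(a, b). h a b) \<circ> (\<lambda>x. (f x, g x)))"
    by (rule continuous_map_compose) simp
  then show ?thesis
    by (simp add: comp_def)
qed

lemma openin_continuous_maps_discrete_eq:
  assumes "continuous_map X (discrete_topology UNIV) f"
    and "continuous_map X (discrete_topology UNIV) g"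
  shows "openin X {x \<in> topspace X. f x = g x}"
  using openin_continuous_map_preimage[OF continuous_map_discrete_compose2[OF assms, of "(=)"],
      of "{True}"] by simp

lemma continuous_map_discrete_step:
  assumes K: "openin X K" "closedin X K"
  shows "continuous_map X (discrete_topology UNIV) (\<lambda>x. if x \<in> K then a else b)"
proof -
  have "{x \<in> topspace X. (if x \<in> K then a else b) \<in> U} =
      (if a \<in> U then K else {}) \<union> (if b \<in> U then topspace X - K else {})" for U
    using openin_subset[OF K(1)] by auto
  then show ?thesis
    using K by (auto simp: continuous_map intro!: openin_Un openin_diff)
qed

lemma closedin_Collect_ball:
  assumes "\<And>i. i \<in> I \<Longrightarrow> closedin X {x \<in> topspace X. P i x}"
  shows "closedin X {x \<in> topspace X. \<forall>i\<in>I. P i x}"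
proof (cases "I = {}")
  case False
  then have "{x \<in> topspace X. \<forall>i\<in>I. P i x} = (\<Inter>i\<in>I. {x \<in> topspace X. P i x})"
    by auto
  then show ?thesis
    using assms False by (auto intro: closedin_INT)
qed simp

section \<open>Prime filters of Heyting algebras\<close>

locale heyting_algebra =
  fixes A :: "('l::finite, 'a) vl_struct"
  assumes heyting_alg: "heyting_alg A"
begin

abbreviation meet (infixl "\<sqinter>" 70) where "x \<sqinter> y \<equiv> vmeet A x y"
abbreviation join (infixl "\<squnion>" 65) where "x \<squnion> y \<equiv> vjoin A x y"
abbreviation imp (infixr "\<leadsto>" 60) where "x \<leadsto> y \<equiv> vimp A x y"
abbreviation le (infix "\<sqsubseteq>" 50) where "x \<sqsubseteq> y \<equiv> vle A x y"

lemma ops_closed [simp, intro]: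
  "vzero A \<in> vcarrier A" "vone A \<in> vcarrier A"
  "x \<in> vcarrier A \<Longrightarrow> y \<in> vcarrier A \<Longrightarrow> x \<sqinter> y \<in> vcarrier A"
  "x \<in> vcarrier A \<Longrightarrow> y \<in> vcarrier A \<Longrightarrow> x \<squnion> y \<in> vcarrier A"
  "x \<in> vcarrier A \<Longrightarrow> y \<in> vcarrier A \<Longrightarrow> (x \<leadsto> y) \<in> vcarrier A"
  using heyting_alg unfolding heyting_alg_def by blast+

lemma meet_commute: "x \<in> vcarrier A \<Longrightarrow> y \<in> vcarrier A \<Longrightarrow> x \<sqinter> y = y \<sqinter> x"
  using heyting_alg unfolding heyting_alg_def by blast

lemma join_commute: "x \<in> vcarrier A \<Longrightarrow> y \<in> vcarrier A \<Longrightarrow> x \<squnion> y = y \<squnion> x"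
  using heyting_alg unfolding heyting_alg_def by blast

lemma meet_join_absorb: "x \<in> vcarrier A \<Longrightarrow> y \<in> vcarrier A \<Longrightarrow> x \<sqinter> (x \<squnion> y) = x"
  using heyting_alg unfolding heyting_alg_def by blast

lemma join_meet_absorb: "x \<in> vcarrier A \<Longrightarrow> y \<in> vcarrier A \<Longrightarrow> x \<squnion> x \<sqinter> y = x"
  using heyting_alg unfolding heyting_alg_def by blast

lemma meet_assoc:
  "x \<in> vcarrier A \<Longrightarrow> y \<in> vcarrier A \<Longrightarrow> z \<in> vcarrier A \<Longrightarrow> x \<sqinter> y \<sqinter> z = x \<sqinter> (y \<sqinter> z)"
  by (rule sym) (use heyting_alg in \<open>unfold heyting_alg_def, blast\<close>)

lemma join_assoc:
  "x \<in> vcarrier A \<Longrightarrow> y \<in> vcarrier A \<Longrightarrow> z \<in> vcarrier A \<Longrightarrow> x \<squnion> y \<squnion> z = x \<squnion> (y \<squnion> z)"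
  by (rule sym) (use heyting_alg in \<open>unfold heyting_alg_def, blast\<close>)

lemma zero_le: "x \<in> vcarrier A \<Longrightarrow> vzero A \<sqsubseteq> x"
  using heyting_alg unfolding heyting_alg_def vle_def by blast

lemma one_meet [simp]: "x \<in> vcarrier A \<Longrightarrow> vone A \<sqinter> x = x"
  using heyting_alg unfolding heyting_alg_def by blast

lemma le_imp_iff:
  "x \<in> vcarrier A \<Longrightarrow> y \<in> vcarrier A \<Longrightarrow> z \<in> vcarrier A \<Longrightarrow> z \<sqsubseteq> (x \<leadsto> y) \<longleftrightarrow> z \<sqinter> x \<sqsubseteq> y"
  using heyting_alg unfolding heyting_alg_def by blast

lemma meet_idem: "x \<in> vcarrier A \<Longrightarrow> x \<sqinter> x = x"
  by (metis join_meet_absorb meet_join_absorb ops_closed(3))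

lemma le_refl: "x \<in> vcarrier A \<Longrightarrow> x \<sqsubseteq> x"
  by (simp add: vle_def meet_idem)

lemma le_antisym: "x \<in> vcarrier A \<Longrightarrow> y \<in> vcarrier A \<Longrightarrow> x \<sqsubseteq> y \<Longrightarrow> y \<sqsubseteq> x \<Longrightarrow> x = y"
  unfolding vle_def by (metis meet_commute)

lemma le_trans:
  assumes "x \<sqsubseteq> y" "y \<sqsubseteq> z" "x \<in> vcarrier A" "y \<in> vcarrier A" "z \<in> vcarrier A"
  shows "x \<sqsubseteq> z"
  using assms unfolding vle_def by (metis meet_assoc)

lemma meet_le1: "x \<in> vcarrier A \<Longrightarrow> y \<in> vcarrier A \<Longrightarrow> x \<sqinter> y \<sqsubseteq> x"
  unfolding vle_def by (metis meet_assoc meet_commute meet_idem ops_closed(3))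

lemma meet_le2: "x \<in> vcarrier A \<Longrightarrow> y \<in> vcarrier A \<Longrightarrow> x \<sqinter> y \<sqsubseteq> y"
  by (metis meet_commute meet_le1)

lemma meet_greatest:
  assumes "z \<sqsubseteq> x" "z \<sqsubseteq> y" "x \<in> vcarrier A" "y \<in> vcarrier A" "z \<in> vcarrier A"
  shows "z \<sqsubseteq> x \<sqinter> y"
  using assms unfolding vle_def by (metis meet_assoc)

lemma meet_mono_left:
  assumes "x \<sqsubseteq> y" "x \<in> vcarrier A" "y \<in> vcarrier A" "z \<in> vcarrier A"
  shows "x \<sqinter> z \<sqsubseteq> y \<sqinter> z"
  using assms by (meson le_trans meet_greatest meet_le1 meet_le2 ops_closed(3))

lemma le_iff_join: "x \<in> vcarrier A \<Longrightarrow> y \<in> vcarrier A \<Longrightarrow> x \<sqsubseteq> y \<longleftrightarrow> x \<squnion> y = y"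
  unfolding vle_def by (metis join_commute join_meet_absorb meet_commute meet_join_absorb)

lemma join_ge1: "x \<in> vcarrier A \<Longrightarrow> y \<in> vcarrier A \<Longrightarrow> x \<sqsubseteq> x \<squnion> y"
  unfolding vle_def by (rule meet_join_absorb)

lemma join_ge2: "x \<in> vcarrier A \<Longrightarrow> y \<in> vcarrier A \<Longrightarrow> y \<sqsubseteq> x \<squnion> y"
  by (metis join_commute join_ge1)

lemma join_least:
  assumes "x \<sqsubseteq> z" "y \<sqsubseteq> z" "x \<in> vcarrier A" "y \<in> vcarrier A" "z \<in> vcarrier A"
  shows "x \<squnion> y \<sqsubseteq> z"
  using assms by (simp add: le_iff_join join_assoc)

lemma le_one: "x \<in> vcarrier A \<Longrightarrow> x \<sqsubseteq> vone A"
  unfolding vle_def by (metis meet_commute one_meet ops_closed(2))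

lemma one_le_iff: "x \<in> vcarrier A \<Longrightarrow> vone A \<sqsubseteq> x \<longleftrightarrow> x = vone A"
  using le_antisym le_one le_refl by blast

lemma imp_eq_one_iff: "x \<in> vcarrier A \<Longrightarrow> y \<in> vcarrier A \<Longrightarrow> (x \<leadsto> y) = vone A \<longleftrightarrow> x \<sqsubseteq> y"
  using le_imp_iff[of x y "vone A"] one_le_iff by simp

lemma viff_eq_one_iff:
  assumes "x \<in> vcarrier A" "y \<in> vcarrier A"
  shows "viff A x y = vone A \<longleftrightarrow> x = y"
proof -
  have "viff A x y = vone A \<longleftrightarrow> x \<sqsubseteq> y \<and> y \<sqsubseteq> x"
    unfolding viff_def using assms
    by (metis imp_eq_one_iff meet_le1 meet_le2 one_le_iff one_meet ops_closed(2,5))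
  then show ?thesis
    using assms le_antisym le_refl by blast
qed

lemma foldr_join_closed:
  "(\<And>l. f l \<in> vcarrier A) \<Longrightarrow> foldr (vjoin A) (map f ls) (vzero A) \<in> vcarrier A"
  by (induction ls) auto

lemma vBigJoin_upper:
  assumes f: "\<And>l. f l \<in> vcarrier A"
  shows "f l \<sqsubseteq> vBigJoin A f"
proof -
  let ?J = "\<lambda>ls. foldr (vjoin A) (map f ls) (vzero A)"
  have J_closed: "?J ls \<in> vcarrier A" for ls
    using f by (rule foldr_join_closed)
  have "f l \<sqsubseteq> ?J ls" if "l \<in> set ls" for ls
    using that
  proof (induction ls)
    case (Cons k ls)
    show ?case
    proof (cases "k = l")
      case False
      then have "f l \<sqsubseteq> ?J ls"
        using Cons by simp
      then show ?thesis
        using le_trans[OF _ join_ge2] f J_closed by simp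
    qed (use f J_closed join_ge1 in simp)
  qed simp
  then show ?thesis
    by (simp add: vBigJoin_def set_lvals)
qed

lemma vBigMeet_lower:
  assumes f: "\<And>l. f l \<in> vcarrier A"
  shows "vBigMeet A f \<sqsubseteq> f l"
proof -
  let ?M = "\<lambda>ls. foldr (vmeet A) (map f ls) (vone A)"
  have M_closed: "?M ls \<in> vcarrier A" for ls
    by (induction ls) (use f in auto)
  have "?M ls \<sqsubseteq> f l" if "l \<in> set ls" for ls
    using that
  proof (induction ls)
    case (Cons k ls)
    show ?case
    proof (cases "k = l")
      case False
      then have "?M ls \<sqsubseteq> f l"
        using Cons by simp
      then show ?thesis
        using le_trans[OF meet_le2] f M_closed by simp
    qed (use f M_closed meet_le1 in simp)
  qed simp
  then show ?thesis
    by (simp add: vBigMeet_def set_lvals)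
qed

lemma vBigMeet_one: "vBigMeet A (\<lambda>_. vone A) = vone A"
proof -
  have "foldr (vmeet A) (map (\<lambda>_. vone A) ls) (vone A) = vone A" for ls :: "'l list"
    by (induction ls) simp_all
  then show ?thesis
    by (simp add: vBigMeet_def)
qed

definition vfilter :: "'a set \<Rightarrow> bool" where
  "vfilter P \<longleftrightarrow> P \<subseteq> vcarrier A \<and> vone A \<in> P \<and> (\<forall>x\<in>P. \<forall>y\<in>P. x \<sqinter> y \<in> P) \<and>
     (\<forall>x\<in>P. \<forall>y\<in>vcarrier A. x \<sqsubseteq> y \<longrightarrow> y \<in> P)"

definition prime_vfilter :: "'a set \<Rightarrow> bool" where
  "prime_vfilter P \<longleftrightarrow> vfilter P \<and> vzero A \<notin> P \<and>
     (\<forall>x\<in>vcarrier A. \<forall>y\<in>vcarrier A. x \<squnion> y \<in> P \<longrightarrow> x \<in> P \<or> y \<in> P)"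

definition vfilter_adjoin :: "'a set \<Rightarrow> 'a \<Rightarrow> 'a set" where
  "vfilter_adjoin P x = {y \<in> vcarrier A. \<exists>p\<in>P. p \<sqinter> x \<sqsubseteq> y}"

lemma vfilter_upward: "vfilter P \<Longrightarrow> x \<in> P \<Longrightarrow> x \<sqsubseteq> y \<Longrightarrow> y \<in> vcarrier A \<Longrightarrow> y \<in> P"
  unfolding vfilter_def by blast

lemma vfilter_meet_iff:
  assumes "vfilter P" "x \<in> vcarrier A" "y \<in> vcarrier A"
  shows "x \<sqinter> y \<in> P \<longleftrightarrow> x \<in> P \<and> y \<in> P"
  using assms vfilter_upward[OF assms(1) _ meet_le1[OF assms(2,3)]]
    vfilter_upward[OF assms(1) _ meet_le2[OF assms(2,3)]] by (auto simp: vfilter_def)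

lemma vfilter_singleton_one: "vfilter {vone A}"
  by (simp add: vfilter_def one_le_iff)

lemma vfilter_vfilter_adjoin:
  assumes P: "vfilter P" and x: "x \<in> vcarrier A"
  shows "vfilter (vfilter_adjoin P x)"
  unfolding vfilter_def
proof (intro conjI ballI impI)
  have P_sub: "P \<subseteq> vcarrier A" and "vone A \<in> P"
    using P by (auto simp: vfilter_def)
  show "vfilter_adjoin P x \<subseteq> vcarrier A"
    by (auto simp: vfilter_adjoin_def)
  show "vone A \<in> vfilter_adjoin P x"
    unfolding vfilter_adjoin_def using \<open>vone A \<in> P\<close> x le_one ops_closed by blast
  show "z \<in> vfilter_adjoin P x"
    if "y \<in> vfilter_adjoin P x" "z \<in> vcarrier A" "y \<sqsubseteq> z" for y z
    using that P_sub x le_trans unfolding vfilter_adjoin_def by blast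
  show "y \<sqinter> z \<in> vfilter_adjoin P x"
    if yz: "y \<in> vfilter_adjoin P x" "z \<in> vfilter_adjoin P x" for y z
  proof -
    obtain p q where p: "p \<in> P" "p \<sqinter> x \<sqsubseteq> y" and q: "q \<in> P" "q \<sqinter> x \<sqsubseteq> z"
      using yz by (auto simp: vfilter_adjoin_def)
    have yz_carrier: "y \<in> vcarrier A" "z \<in> vcarrier A"
      using yz by (auto simp: vfilter_adjoin_def)
    have pq: "p \<in> vcarrier A" "q \<in> vcarrier A"
      using p q P_sub by auto
    have "p \<sqinter> q \<sqinter> x \<sqsubseteq> p \<sqinter> x" "p \<sqinter> q \<sqinter> x \<sqsubseteq> q \<sqinter> x"
      using pq x by (simp_all add: meet_mono_left meet_le1 meet_le2)
    then have "p \<sqinter> q \<sqinter> x \<sqsubseteq> y \<sqinter> z"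
      using p(2) q(2) pq x yz_carrier by (meson le_trans meet_greatest ops_closed(3))
    moreover have "p \<sqinter> q \<in> P"
      using P p q by (simp add: vfilter_def)
    ultimately show ?thesis
      using yz_carrier unfolding vfilter_adjoin_def by blast
  qed
qed

lemma subset_vfilter_adjoin: "vfilter P \<Longrightarrow> x \<in> vcarrier A \<Longrightarrow> P \<subseteq> vfilter_adjoin P x"
  unfolding vfilter_adjoin_def vfilter_def using meet_le1 by blast

lemma in_vfilter_adjoin: "vfilter P \<Longrightarrow> x \<in> vcarrier A \<Longrightarrow> x \<in> vfilter_adjoin P x"
  unfolding vfilter_adjoin_def vfilter_def using meet_le2 by blast

lemma vfilter_Union_chain:
  assumes "\<C> \<noteq> {}" "subset.chain (Collect vfilter) \<C>"
  shows "vfilter (\<Union>\<C>)"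
  unfolding vfilter_def
proof (intro conjI ballI impI)
  have filters: "\<And>P. P \<in> \<C> \<Longrightarrow> vfilter P" and chain: "\<And>P Q. P \<in> \<C> \<Longrightarrow> Q \<in> \<C> \<Longrightarrow> P \<subseteq> Q \<or> Q \<subseteq> P"
    using assms(2) by (auto simp: subset_chain_def)
  show "\<Union>\<C> \<subseteq> vcarrier A" "vone A \<in> \<Union>\<C>"
    using filters assms(1) unfolding vfilter_def by blast+
  show "y \<in> \<Union>\<C>" if "x \<in> \<Union>\<C>" "y \<in> vcarrier A" "x \<sqsubseteq> y" for x y
    using that filters vfilter_upward by blast
  show "x \<sqinter> y \<in> \<Union>\<C>" if xy: "x \<in> \<Union>\<C>" "y \<in> \<Union>\<C>" for x y
  proof -
    obtain R where "R \<in> \<C>" "x \<in> R" "y \<in> R"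
      using xy chain by blast
    then show ?thesis
      using filters unfolding vfilter_def by blast
  qed
qed

lemma ex_maximal_vfilter_avoiding:
  assumes xy: "x \<in> vcarrier A" "\<not> x \<sqsubseteq> y"
  shows "\<exists>M. vfilter M \<and> x \<in> M \<and> y \<notin> M \<and> (\<forall>P. vfilter P \<and> M \<subseteq> P \<and> y \<notin> P \<longrightarrow> P = M)"
proof -
  define \<F> where "\<F> = {P. vfilter P \<and> x \<in> P \<and> y \<notin> P}"
  have "vfilter_adjoin {vone A} x \<in> \<F>"
    using xy vfilter_vfilter_adjoin in_vfilter_adjoin vfilter_singleton_one
    by (simp add: \<F>_def) (simp add: vfilter_adjoin_def)
  moreover have "\<Union>\<C> \<in> \<F>" if "\<C> \<noteq> {}" "subset.chain \<F> \<C>" for \<C>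
  proof -
    have "\<forall>P\<in>\<C>. x \<in> P \<and> y \<notin> P" "subset.chain (Collect vfilter) \<C>"
      using that(2) by (auto simp: subset_chain_def \<F>_def)
    then show ?thesis
      using vfilter_Union_chain that(1) by (auto simp: \<F>_def)
  qed
  ultimately have "\<exists>M\<in>\<F>. \<forall>X\<in>\<F>. M \<subseteq> X \<longrightarrow> X = M"
    by (intro subset_Zorn_nonempty) auto
  then show ?thesis
    unfolding \<F>_def by blast
qed

lemma meet_imps_meet_join_le:
  assumes "x \<in> vcarrier A" "y \<in> vcarrier A" "z \<in> vcarrier A"
  shows "((x \<leadsto> z) \<sqinter> (y \<leadsto> z)) \<sqinter> (x \<squnion> y) \<sqsubseteq> z"
proof -
  let ?r = "(x \<leadsto> z) \<sqinter> (y \<leadsto> z)"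
  have "?r \<sqinter> x \<sqsubseteq> z" "?r \<sqinter> y \<sqsubseteq> z"
    using le_imp_iff[of x z ?r] le_imp_iff[of y z ?r] assms by (simp_all add: meet_le1 meet_le2)
  then have "x \<sqsubseteq> (?r \<leadsto> z)" "y \<sqsubseteq> (?r \<leadsto> z)"
    using assms by (simp_all add: le_imp_iff meet_commute[of _ ?r])
  then have "x \<squnion> y \<sqsubseteq> (?r \<leadsto> z)"
    using assms by (simp add: join_least)
  then show ?thesis
    using assms by (simp add: le_imp_iff meet_commute[of _ ?r])
qed

theorem prime_vfilter_separation:
  assumes x: "x \<in> vcarrier A" and y: "y \<in> vcarrier A" and "\<not> x \<sqsubseteq> y"
  shows "\<exists>P. prime_vfilter P \<and> x \<in> P \<and> y \<notin> P"
proof -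
  obtain M where M: "vfilter M" "x \<in> M" "y \<notin> M"
    and maximal: "\<And>P. vfilter P \<Longrightarrow> M \<subseteq> P \<Longrightarrow> y \<notin> P \<Longrightarrow> P = M"
    using ex_maximal_vfilter_avoiding x \<open>\<not> x \<sqsubseteq> y\<close> by metis
  have imp_mem: "(a \<leadsto> y) \<in> M" if a: "a \<in> vcarrier A" "a \<notin> M" for a
  proof -
    have "y \<in> vfilter_adjoin M a"
      using maximal vfilter_vfilter_adjoin subset_vfilter_adjoin in_vfilter_adjoin M(1) a by metis
    then obtain p where "p \<in> M" "p \<sqinter> a \<sqsubseteq> y"
      unfolding vfilter_adjoin_def by blast
    then have "p \<sqsubseteq> (a \<leadsto> y)"
      using M(1) a y by (auto simp: vfilter_def le_imp_iff)
    then show ?thesis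
      using vfilter_upward M(1) \<open>p \<in> M\<close> a y by blast
  qed
  have "a \<in> M \<or> b \<in> M" if ab: "a \<in> vcarrier A" "b \<in> vcarrier A" "a \<squnion> b \<in> M" for a b
  proof (rule ccontr)
    assume "\<not> (a \<in> M \<or> b \<in> M)"
    then have "((a \<leadsto> y) \<sqinter> (b \<leadsto> y)) \<sqinter> (a \<squnion> b) \<in> M"
      using imp_mem ab y M(1) by (simp add: vfilter_meet_iff)
    then show False
      using vfilter_upward[OF M(1)] meet_imps_meet_join_le ab y M(3) by blast
  qed
  moreover have "vzero A \<notin> M"
    using vfilter_upward[OF M(1)] zero_le y M(3) by blast
  ultimately show ?thesis
    using M unfolding prime_vfilter_def by blast
qed

lemma prime_vfilter_vBigJoin:
  assumes P: "prime_vfilter P" and f: "\<And>l. f l \<in> vcarrier A" and "vBigJoin A f \<in> P"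
  shows "\<exists>l. f l \<in> P"
proof -
  have "\<exists>l. f l \<in> P" if "foldr (vjoin A) (map f ls) (vzero A) \<in> P" for ls
    using that
  proof (induction ls)
    case (Cons l ls)
    then show ?case
      using P f foldr_join_closed[of f ls] by (auto simp: prime_vfilter_def)
  qed (use P in \<open>simp add: prime_vfilter_def\<close>)
  then show ?thesis
    using \<open>vBigJoin A f \<in> P\<close> by (auto simp: vBigJoin_def)
qed

end

section \<open>Homomorphisms into \<open>L\<close>\<close>

lemma L_alg_simps [simp]:
  "vcarrier L_alg = UNIV" "vmeet L_alg = inf" "vjoin L_alg = sup" "vimp L_alg = himpL"
  "vT L_alg = TL" "vzero L_alg = bot" "vone L_alg = top"
  by (simp_all add: L_alg_def)

lemma vle_L_alg_iff [simp]: "vle L_alg x y \<longleftrightarrow> x \<le> y"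
  by (simp add: vle_def le_iff_inf)

lemma heyting_alg_L_alg: "heyting_alg L_alg"
  unfolding heyting_alg_def
  by (auto simp: le_himpL_iff inf.commute inf.left_commute sup.commute sup.left_commute)

lemma vl_alg_L_alg: "vl_alg (L_alg :: ('l::finite_distrib_lattice, 'l) vl_struct)"
proof -
  interpret L: heyting_algebra "L_alg :: ('l, 'l) vl_struct"
    by (unfold_locales) (rule heyting_alg_L_alg)
  have "vBigJoin L_alg (\<lambda>l. TL l x) = top" for x :: 'l
    using L.vBigJoin_upper[of "\<lambda>l. TL l x" x] by (simp add: TL_def top_unique)
  moreover have "vBigMeet L_alg (\<lambda>l. viff L_alg (TL l x) (TL l y)) \<le> viff L_alg x y" for x y :: 'l
  proof (cases "x = y")
    case False
    then have "viff L_alg (TL x x) (TL x y) = bot"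
      by (simp add: viff_def TL_def)
    then show ?thesis
      using L.vBigMeet_lower[of "\<lambda>l. viff L_alg (TL l x) (TL l y)" x] by (simp add: bot_unique)
  qed (use L.viff_eq_one_iff[of x y] in simp)
  ultimately show ?thesis
    unfolding vl_alg_def using heyting_alg_L_alg
    by (auto simp: TL_def himpL_eq_top_iff)
qed

lemma vhomD:
  assumes "f \<in> vhom A C"
  shows "f \<in> extensional (vcarrier A)"
    "x \<in> vcarrier A \<Longrightarrow> f x \<in> vcarrier C"
    "x \<in> vcarrier A \<Longrightarrow> y \<in> vcarrier A \<Longrightarrow> f (vmeet A x y) = vmeet C (f x) (f y)"
    "x \<in> vcarrier A \<Longrightarrow> y \<in> vcarrier A \<Longrightarrow> f (vjoin A x y) = vjoin C (f x) (f y)"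
    "x \<in> vcarrier A \<Longrightarrow> y \<in> vcarrier A \<Longrightarrow> f (vimp A x y) = vimp C (f x) (f y)"
    "x \<in> vcarrier A \<Longrightarrow> f (vT A l x) = vT C l (f x)"
    "f (vzero A) = vzero C" "f (vone A) = vone C"
  using assms by (auto simp: vhom_def PiE_iff)

lemma vhom_L_simps:
  assumes "v \<in> vhom A L_alg"
  shows "x \<in> vcarrier A \<Longrightarrow> y \<in> vcarrier A \<Longrightarrow> v (vmeet A x y) = inf (v x) (v y)"
    "x \<in> vcarrier A \<Longrightarrow> y \<in> vcarrier A \<Longrightarrow> v (vjoin A x y) = sup (v x) (v y)"
    "x \<in> vcarrier A \<Longrightarrow> y \<in> vcarrier A \<Longrightarrow> v (vimp A x y) = himpL (v x) (v y)"
    "x \<in> vcarrier A \<Longrightarrow> v (vT A l x) = TL l (v x)"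
    "v (vzero A) = bot" "v (vone A) = top"
  using vhomD(3-)[OF assms] by simp_all

locale vl_algebra = heyting_algebra A
  for A :: "('l::finite_distrib_lattice, 'a) vl_struct" +
  assumes vl_alg: "vl_alg A"
begin

lemma T_closed [simp, intro]: "x \<in> vcarrier A \<Longrightarrow> vT A l x \<in> vcarrier A"
  using vl_alg by (simp add: vl_alg_def)

lemma T_op_le:
  assumes "a \<in> vcarrier A" "b \<in> vcarrier A"
  shows "vT A p a \<sqinter> vT A q b \<sqsubseteq>
      vT A (himpL p q) (a \<leadsto> b) \<sqinter> (vT A (inf p q) (a \<sqinter> b) \<sqinter> vT A (sup p q) (a \<squnion> b))"
  using vl_alg assms by (simp add: vl_alg_def)

lemma T_le_T_T: "a \<in> vcarrier A \<Longrightarrow> vT A q a \<sqsubseteq> vT A (TL p q) (vT A p a)"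
  using vl_alg by (auto simp: vl_alg_def ball_conj_distrib)

lemma T_const: "vT A bot (vzero A) = vone A" "vT A top (vone A) = vone A"
  using vl_alg by (simp_all add: vl_alg_def)

lemma T_BigJoin: "a \<in> vcarrier A \<Longrightarrow> vBigJoin A (\<lambda>l. vT A l a) = vone A"
  using vl_alg by (simp add: vl_alg_def)

lemma T_disjoint: "a \<in> vcarrier A \<Longrightarrow> l \<noteq> k \<Longrightarrow> vT A l a \<sqinter> vT A k a = vzero A"
  using vl_alg by (simp add: vl_alg_def)

lemma T_viff_le:
  assumes "a \<in> vcarrier A" "b \<in> vcarrier A"
  shows "vBigMeet A (\<lambda>l. viff A (vT A l a) (vT A l b)) \<sqsubseteq> viff A a b"
  using vl_alg assms by (simp add: vl_alg_def)

lemma eq_if_all_T_eq: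
  assumes a: "a \<in> vcarrier A" and b: "b \<in> vcarrier A" and T_eq: "\<And>l. vT A l a = vT A l b"
  shows "a = b"
proof -
  have "viff A (vT A l a) (vT A l b) = vone A" for l
    using T_eq a b by (simp add: viff_eq_one_iff)
  then have "vone A \<sqsubseteq> viff A a b"
    using T_viff_le[OF a b] vBigMeet_one by simp
  then have "viff A a b = vone A"
    using a b by (simp add: viff_def one_le_iff)
  then show ?thesis
    using a b by (simp add: viff_eq_one_iff)
qed

lemma prime_vfilter_ex1_T:
  assumes P: "prime_vfilter P" and a: "a \<in> vcarrier A"
  shows "\<exists>!l. vT A l a \<in> P"
proof -
  have "\<exists>l. vT A l a \<in> P"
    using prime_vfilter_vBigJoin[OF P, of "\<lambda>l. vT A l a"] P a
    by (simp add: T_BigJoin prime_vfilter_def vfilter_def)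
  moreover have "l = k" if "vT A l a \<in> P" "vT A k a \<in> P" for l k
  proof (rule ccontr)
    assume "l \<noteq> k"
    then have "vT A l a \<sqinter> vT A k a \<notin> P"
      using P T_disjoint[OF a] by (simp add: prime_vfilter_def)
    then show False
      using that P a by (simp add: prime_vfilter_def vfilter_meet_iff)
  qed
  ultimately show ?thesis
    by blast
qed

definition vhom_of_vfilter :: "'a set \<Rightarrow> 'a \<Rightarrow> 'l" where
  "vhom_of_vfilter P = (\<lambda>a\<in>vcarrier A. THE l. vT A l a \<in> P)"

lemma vhom_of_vfilter_eq_iff:
  assumes "prime_vfilter P" "a \<in> vcarrier A"
  shows "vhom_of_vfilter P a = l \<longleftrightarrow> vT A l a \<in> P"
  using theI'[OF prime_vfilter_ex1_T[OF assms]] prime_vfilter_ex1_T[OF assms] assms(2)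
  by (auto simp: vhom_of_vfilter_def)

lemma vhom_of_vfilter_in_vhom:
  assumes P: "prime_vfilter P"
  shows "vhom_of_vfilter P \<in> vhom A L_alg"
  unfolding vhom_def L_alg_simps
proof (intro CollectI conjI ballI allI)
  let ?v = "vhom_of_vfilter P"
  note v_eq_iff = vhom_of_vfilter_eq_iff[OF P]
  have filter: "vfilter P"
    using P by (simp add: prime_vfilter_def)
  show "?v \<in> vcarrier A \<rightarrow>\<^sub>E UNIV"
    by (simp add: vhom_of_vfilter_def)
  show "?v (vzero A) = bot" "?v (vone A) = top"
    using filter by (simp_all add: v_eq_iff T_const vfilter_def)
  fix a assume a: "a \<in> vcarrier A"
  have v_a: "vT A (?v a) a \<in> P"
    using v_eq_iff a by blast
  show "?v (vT A l a) = TL l (?v a)" for l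
    using vfilter_upward[OF filter v_a T_le_T_T[OF a]] a by (simp add: v_eq_iff)
  fix b assume b: "b \<in> vcarrier A"
  have "vT A (?v b) b \<in> P"
    using v_eq_iff b by blast
  then have "vT A (?v a) a \<sqinter> vT A (?v b) b \<in> P"
    using filter v_a a b by (simp add: vfilter_meet_iff)
  from vfilter_upward[OF filter this T_op_le[OF a b]]
  show "?v (a \<sqinter> b) = inf (?v a) (?v b)" "?v (a \<squnion> b) = sup (?v a) (?v b)"
    "?v (a \<leadsto> b) = himpL (?v a) (?v b)"
    using filter a b by (simp_all add: v_eq_iff vfilter_meet_iff)
qed

lemma ex_vhom_separating_T:
  assumes "a \<in> vcarrier A" "b \<in> vcarrier A" "\<not> vT A l a \<sqsubseteq> vT A l b"
  shows "\<exists>v\<in>vhom A L_alg. v a = l \<and> v b \<noteq> l"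
proof -
  obtain P where "prime_vfilter P" "vT A l a \<in> P" "vT A l b \<notin> P"
    using prime_vfilter_separation[of "vT A l a" "vT A l b"] assms by auto
  then show ?thesis
    using vhom_of_vfilter_in_vhom vhom_of_vfilter_eq_iff assms by blast
qed

lemma ex_vhom_separating:
  assumes "a \<in> vcarrier A" "b \<in> vcarrier A" "a \<noteq> b"
  shows "\<exists>v\<in>vhom A L_alg. v a \<noteq> v b"
proof -
  obtain l where "vT A l a \<noteq> vT A l b"
    using eq_if_all_T_eq assms by blast
  then have "\<not> vT A l a \<sqsubseteq> vT A l b \<or> \<not> vT A l b \<sqsubseteq> vT A l a"
    using le_antisym assms(1,2) by blast
  then show ?thesis
    using ex_vhom_separating_T assms(1,2) by metis
qed

lemma vhom_compose:
  assumes g: "g \<in> vhom A C" and h: "h \<in> vhom C E"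
  shows "compose (vcarrier A) h g \<in> vhom A E"
  using assms unfolding vhom_def by (simp add: compose_def PiE_iff)

lemma vhom_image_SigmaL:
  assumes v: "v \<in> vhom A L_alg"
  shows "v ` vcarrier A \<in> SigmaL"
  unfolding SigmaL_def
proof (intro CollectI conjI ballI allI)
  show "bot \<in> v ` vcarrier A" "top \<in> v ` vcarrier A"
    using vhom_L_simps(5,6)[OF v] by (metis imageI ops_closed(1,2))+
  fix x assume "x \<in> v ` vcarrier A"
  then obtain a where a: "a \<in> vcarrier A" "x = v a"
    by blast
  show "TL p x \<in> v ` vcarrier A" for p
    using vhom_L_simps(4)[OF v a(1)] a by (metis imageI T_closed)
  fix y assume "y \<in> v ` vcarrier A"
  then obtain b where b: "b \<in> vcarrier A" "y = v b"
    by blast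
  show "inf x y \<in> v ` vcarrier A" "sup x y \<in> v ` vcarrier A" "himpL x y \<in> v ` vcarrier A"
    using vhom_L_simps(1-3)[OF v a(1) b(1)] a b by (metis imageI ops_closed(3-5))+
qed

lemma closedin_vhom:
  "closedin (product_topology (\<lambda>_. discrete_topology (vcarrier C)) (vcarrier A)) (vhom A C)"
proof -
  let ?K = "product_topology (\<lambda>_. discrete_topology (vcarrier C)) (vcarrier A)"
  have eval: "continuous_map ?K (discrete_topology UNIV) (\<lambda>v. v a)" if "a \<in> vcarrier A" for a
  proof -
    have "continuous_map ?K (discrete_topology UNIV) (id \<circ> (\<lambda>v. v a))"
      by (rule continuous_map_compose[OF continuous_map_product_projection[OF that]]) simp
    then show ?thesis
      by (simp add: comp_def)
  qed
  have closed_eq: "closedin ?K {v \<in> topspace ?K. v a = h (v b) (v c)}"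
    if "a \<in> vcarrier A" "b \<in> vcarrier A" "c \<in> vcarrier A" for a b c h
    using closedin_continuous_maps_eq[OF Hausdorff_space_discrete_topology eval[OF that(1)]
        continuous_map_discrete_compose2[OF eval[OF that(2)] eval[OF that(3)]]] .
  have closed_const: "closedin ?K {v \<in> topspace ?K. v a = c}" if "a \<in> vcarrier A" for a c
    using closed_eq[OF that that that, where h = "\<lambda>_ _. c"] .
  have closed_T: "closedin ?K {v \<in> topspace ?K. v (vT A l a) = vT C l (v a)}"
    if "a \<in> vcarrier A" for a l
    using closed_eq[OF T_closed[OF that] that that, where h = "\<lambda>x _. vT C l x"] .
  have "vhom A C =
      {v \<in> topspace ?K. \<forall>a\<in>vcarrier A. \<forall>b\<in>vcarrier A. v (a \<sqinter> b) = vmeet C (v a) (v b)} \<inter>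
      {v \<in> topspace ?K. \<forall>a\<in>vcarrier A. \<forall>b\<in>vcarrier A. v (a \<squnion> b) = vjoin C (v a) (v b)} \<inter>
      {v \<in> topspace ?K. \<forall>a\<in>vcarrier A. \<forall>b\<in>vcarrier A. v (a \<leadsto> b) = vimp C (v a) (v b)} \<inter>
      {v \<in> topspace ?K. \<forall>l\<in>UNIV. \<forall>a\<in>vcarrier A. v (vT A l a) = vT C l (v a)} \<inter>
      {v \<in> topspace ?K. v (vzero A) = vzero C} \<inter> {v \<in> topspace ?K. v (vone A) = vone C}"
    unfolding vhom_def by auto
  moreover have "closedin ?K \<dots>"
    by (intro closedin_Int closedin_Collect_ball closed_T closed_const
        closed_eq[where h = "vmeet C"] closed_eq[where h = "vjoin C"] closed_eq[where h = "vimp C"])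
      auto
  ultimately show ?thesis
    by simp
qed

end

lemma vl_algebraI: "vl_alg A \<Longrightarrow> vl_algebra A"
  by unfold_locales (simp_all add: vl_alg_def)

section \<open>The dual space of an algebra\<close>

lemma L_pbs_simps [simp]:
  "ptop1 L_pbs = discrete_topology UNIV" "ptop2 L_pbs = discrete_topology UNIV"
  "palpha L_pbs S = S"
  by (simp_all add: L_pbs_def)

lemma palpha_Gobj: "palpha (Gobj A) S = {v \<in> vhom A L_alg. v ` vcarrier A \<subseteq> S}"
  by (simp add: Gobj_def)

lemma pspace_GobjD: "v \<in> pspace (Gobj A) \<Longrightarrow> v \<in> vhom A L_alg"
  by (auto simp: Gobj_def basic_open_def)

lemma beta_apply: "a \<in> vcarrier A \<Longrightarrow> beta A a = (\<lambda>v\<in>vhom A L_alg. v a)"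
  by (simp add: beta_def)

context vl_algebra
begin

lemma basic_open_meet:
  "a \<in> vcarrier A \<Longrightarrow> b \<in> vcarrier A \<Longrightarrow> basic_open A (a \<sqinter> b) = basic_open A a \<inter> basic_open A b"
  by (auto simp: basic_open_def vhom_L_simps)

lemma pspace_Gobj: "pspace (Gobj A) = vhom A L_alg"
proof -
  have "basic_open A (vone A) = vhom A L_alg"
    by (auto simp: basic_open_def vhom_L_simps)
  then have "\<Union>(basic_open A ` vcarrier A) = vhom A L_alg"
    using ops_closed(2) by (auto simp: basic_open_def)
  then show ?thesis
    by (simp add: Gobj_def)
qed

lemma openin_basic_open: "a \<in> vcarrier A \<Longrightarrow> openin (ptop1 (Gobj A)) (basic_open A a)"
  by (simp add: Gobj_def topology_generated_by_Basis)

lemma ex_basic_open_subset: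
  assumes "openin (ptop1 (Gobj A)) U" "v \<in> U"
  shows "\<exists>b\<in>vcarrier A. v \<in> basic_open A b \<and> basic_open A b \<subseteq> U"
proof -
  have "generate_topology_on (basic_open A ` vcarrier A) U"
    using assms(1) by (simp add: Gobj_def openin_topology_generated_by_iff)
  then show ?thesis
    using assms(2)
  proof (induction arbitrary: v rule: generate_topology_on.induct)
    case (Int X Y)
    then obtain b c where "b \<in> vcarrier A" "c \<in> vcarrier A" "v \<in> basic_open A b"
      "v \<in> basic_open A c" "basic_open A b \<subseteq> X" "basic_open A c \<subseteq> Y"
      by (metis IntD1 IntD2)
    then show ?case
      by (intro bexI[of _ "b \<sqinter> c"]) (auto simp: basic_open_meet)
  next
    case (UN \<K>)
    then obtain X where X: "X \<in> \<K>" "v \<in> X"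
      by blast
    then show ?case
      using UN.IH[OF X] by blast
  qed auto
qed

lemma inj_on_beta: "inj_on (beta A) (vcarrier A)"
proof (rule inj_onI, rule ccontr)
  fix a b assume ab: "a \<in> vcarrier A" "b \<in> vcarrier A" "beta A a = beta A b" "a \<noteq> b"
  then obtain v where "v \<in> vhom A L_alg" "v a \<noteq> v b"
    using ex_vhom_separating by blast
  then show False
    using fun_cong[OF ab(3), of v] ab(1,2) by (simp add: beta_apply)
qed

end

locale nontrivial_vl_algebra = vl_algebra A
  for A :: "('l::finite_distrib_lattice, 'a) vl_struct" +
  assumes bot_neq_top: "(bot::'l) \<noteq> top"
begin

lemma basic_open_T:
  "a \<in> vcarrier A \<Longrightarrow> basic_open A (vT A l a) = {v \<in> vhom A L_alg. v a = l}"
  using bot_neq_top by (auto simp: basic_open_def vhom_L_simps TL_eq_top_iff)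

lemma basic_open_Compl:
  "a \<in> vcarrier A \<Longrightarrow> basic_open A (vT A top a \<leadsto> vzero A) = vhom A L_alg - basic_open A a"
  using bot_neq_top
  by (auto simp: basic_open_def vhom_L_simps himpL_eq_top_iff TL_def bot_unique)

lemma ptop2_Gobj: "ptop2 (Gobj A) = ptop1 (Gobj A)"
proof -
  have "basic_open A a \<in> (\<lambda>a. vhom A L_alg - basic_open A a) ` vcarrier A"
    if "a \<in> vcarrier A" for a
  proof
    show "basic_open A a = vhom A L_alg - basic_open A (vT A top a \<leadsto> vzero A)"
      using basic_open_Compl[OF that] by (auto simp: basic_open_def)
  qed (use that in simp)
  moreover have "vhom A L_alg - basic_open A a \<in> basic_open A ` vcarrier A"
    if "a \<in> vcarrier A" for a
    using basic_open_Compl[OF that] that by (metis imageI T_closed ops_closed(1,5))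
  ultimately have "(\<lambda>a. vhom A L_alg - basic_open A a) ` vcarrier A = basic_open A ` vcarrier A"
    by blast
  then show ?thesis
    by (simp add: Gobj_def)
qed

lemma closedin_basic_open:
  assumes a: "a \<in> vcarrier A"
  shows "closedin (ptop1 (Gobj A)) (basic_open A a)"
  using openin_basic_open[of "vT A top a \<leadsto> vzero A"] a
  by (auto simp: closedin_def basic_open_Compl pspace_Gobj) (simp add: basic_open_def)

lemma continuous_map_eval:
  assumes a: "a \<in> vcarrier A"
  shows "continuous_map (ptop1 (Gobj A)) (discrete_topology UNIV) (\<lambda>v. v a)"
proof -
  have "{v \<in> vhom A L_alg. v a \<in> U} = (\<Union>l\<in>U. basic_open A (vT A l a))" for U
    using a by (auto simp: basic_open_T)
  then show ?thesis
    using a openin_basic_open by (auto simp: continuous_map pspace_Gobj)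
qed

lemma ptop1_Gobj:
  "ptop1 (Gobj A) =
    subtopology (product_topology (\<lambda>_. discrete_topology UNIV) (vcarrier A)) (vhom A L_alg)"
  (is "_ = subtopology ?K _")
proof -
  let ?H = "subtopology ?K (vhom A L_alg)"
  have vhom_subset: "vhom A L_alg \<subseteq> topspace ?K"
    by (auto simp: vhom_def)
  have space_eq: "pspace (Gobj A) = topspace ?H"
    using vhom_subset by (auto simp: pspace_Gobj)
  have "continuous_map (ptop1 (Gobj A)) ?H id"
    using continuous_map_eval
    by (auto simp: continuous_map_in_subtopology continuous_map_componentwise pspace_Gobj vhomD)
  moreover have "continuous_map ?H (ptop1 (Gobj A)) id"
    unfolding Gobj_def pbs.simps
  proof (rule continuous_on_generated_topo)
    fix U assume "U \<in> basic_open A ` vcarrier A"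
    then obtain a where a: "a \<in> vcarrier A" "U = basic_open A a"
      by blast
    have "continuous_map ?K (discrete_topology UNIV) (\<lambda>v. v a)"
      by (rule continuous_map_product_projection[OF a(1)])
    then have "openin ?K {v \<in> topspace ?K. v a \<in> {top}}"
      by (rule openin_continuous_map_preimage) simp
    moreover have "id -` U \<inter> topspace ?H = {v \<in> topspace ?K. v a \<in> {top}} \<inter> vhom A L_alg"
      using a by (auto simp: basic_open_def)
    ultimately show "openin ?H (id -` U \<inter> topspace ?H)"
      by (simp add: openin_subtopology_Int)
  next
    show "id ` topspace ?H \<subseteq> \<Union> (basic_open A ` vcarrier A)"
      using space_eq by (simp add: Gobj_def)
  qed
  ultimately show ?thesis
    unfolding topology_eq using topology_finer_continuous_id space_eq by metis
qed

lemma continuous_map_into_Gobj_iff: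
  "continuous_map X (ptop1 (Gobj A)) f \<longleftrightarrow>
    f \<in> topspace X \<rightarrow> vhom A L_alg \<and>
    (\<forall>a\<in>vcarrier A. continuous_map X (discrete_topology UNIV) (\<lambda>x. f x a))"
  unfolding ptop1_Gobj continuous_map_in_subtopology continuous_map_componentwise
  using vhomD(1)[of _ A L_alg] by blast

lemma stone_space_Gobj: "stone_space (ptop1 (Gobj A))"
  unfolding stone_space_def
proof (intro conjI)
  let ?K = "product_topology (\<lambda>_. discrete_topology (UNIV :: 'l set)) (vcarrier A)"
  have "compact_space ?K"
    by (simp add: compact_space_product_topology compact_space_discrete_topology)
  then show "compact_space (ptop1 (Gobj A))"
    unfolding ptop1_Gobj
    using closedin_vhom[of L_alg] by (simp add: closedin_compact_space compact_space_subtopology)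
  show "Hausdorff_space (ptop1 (Gobj A))"
    unfolding ptop1_Gobj by (simp add: Hausdorff_space_subtopology Hausdorff_space_product_topology)
  show "ptop1 (Gobj A) dim_le 0"
    unfolding dim_le_0_iff_ex_clopen
    by (meson ex_basic_open_subset openin_basic_open closedin_basic_open)
qed

lemma pbs_obj_Gobj: "pbs_obj (Gobj A)"
  unfolding pbs_obj_def
proof (intro conjI ballI)
  show "pairwise_boolean (ptop1 (Gobj A)) (ptop2 (Gobj A))"
    by (simp add: pairwise_boolean_iff ptop2_Gobj stone_space_Gobj)
  show "palpha (Gobj A) UNIV = pspace (Gobj A)"
    by (simp add: palpha_Gobj pspace_Gobj)
  show "palpha (Gobj A) (S \<inter> T) = palpha (Gobj A) S \<inter> palpha (Gobj A) T" for S T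
    by (auto simp: palpha_Gobj)
  show "pairwise_closed (ptop1 (Gobj A)) (ptop2 (Gobj A)) (palpha (Gobj A) S)" for S
  proof -
    have "closedin (ptop1 (Gobj A)) {v \<in> pspace (Gobj A). \<forall>a\<in>vcarrier A. v a \<in> S}"
      by (intro closedin_Collect_ball closedin_continuous_map_preimage[OF continuous_map_eval]) auto
    moreover have "palpha (Gobj A) S = {v \<in> pspace (Gobj A). \<forall>a\<in>vcarrier A. v a \<in> S}"
      by (auto simp: palpha_Gobj pspace_Gobj)
    ultimately show ?thesis
      by (simp add: pairwise_closed_def ptop2_Gobj)
  qed
qed

lemma beta_in_pbs_hom:
  assumes a: "a \<in> vcarrier A"
  shows "beta A a \<in> pbs_hom (Gobj A) L_pbs"
  using a continuous_map_eval[OF a]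
  by (auto simp: pbs_hom_def beta_apply ptop2_Gobj pspace_Gobj palpha_Gobj)

definition eval_patches :: "(('a \<Rightarrow> 'l) \<Rightarrow> 'l) \<Rightarrow> ('a \<Rightarrow> 'l) set set" where
  "eval_patches f =
    {U. \<exists>a\<in>vcarrier A. \<exists>b\<in>vcarrier A. U = basic_open A b \<and> (\<forall>v\<in>U. v a = f v)}"

lemma eval_patches_cover:
  assumes f: "f \<in> pbs_hom (Gobj A) L_pbs"
  shows "vhom A L_alg \<subseteq> \<Union>(eval_patches f)"
proof
  fix v assume v: "v \<in> vhom A L_alg"
  have "v \<in> palpha (Gobj A) (v ` vcarrier A)"
    using v by (simp add: palpha_Gobj)
  then have "f v \<in> v ` vcarrier A"
    using f vhom_image_SigmaL[OF v] by (fastforce simp: pbs_hom_def)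
  then obtain a where a: "a \<in> vcarrier A" "v a = f v"
    by (metis imageE)
  have f_continuous: "continuous_map (ptop1 (Gobj A)) (discrete_topology UNIV) f"
    using f by (simp add: pbs_hom_def)
  let ?E = "{w \<in> pspace (Gobj A). w a = f w}"
  have "openin (ptop1 (Gobj A)) ?E" "v \<in> ?E"
    using openin_continuous_maps_discrete_eq[OF continuous_map_eval[OF a(1)] f_continuous] a(2) v
    by (simp_all add: pspace_Gobj)
  then obtain b where "b \<in> vcarrier A" "v \<in> basic_open A b" "basic_open A b \<subseteq> ?E"
    using ex_basic_open_subset[of ?E v] by blast
  then show "v \<in> \<Union>(eval_patches f)"
    using a(1) unfolding eval_patches_def by blast
qed

lemma ex_glued_patches:
  assumes "finite \<V>" "\<V> \<subseteq> eval_patches f"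
  shows "\<exists>c\<in>vcarrier A. \<forall>v\<in>vhom A L_alg. v c = (if v \<in> \<Union>\<V> then f v else bot)"
  using assms
proof (induction rule: finite_induct)
  case empty
  show ?case
    by (intro bexI[of _ "vzero A"]) (auto simp: vhom_L_simps)
next
  case (insert V \<V>)
  then obtain c where c: "c \<in> vcarrier A"
    "\<And>v. v \<in> vhom A L_alg \<Longrightarrow> v c = (if v \<in> \<Union>\<V> then f v else bot)"
    by auto
  obtain a b where ab: "a \<in> vcarrier A" "b \<in> vcarrier A" and V: "V = basic_open A b"
    and eval_a: "\<And>v. v \<in> basic_open A b \<Longrightarrow> v a = f v"
    using insert.prems by (auto simp: eval_patches_def)
  show ?case
  proof (intro bexI ballI)
    show "(a \<sqinter> vT A top b) \<squnion> c \<in> vcarrier A"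
      using ab c(1) by simp
    fix v assume v: "v \<in> vhom A L_alg"
    have "v ((a \<sqinter> vT A top b) \<squnion> c) = sup (inf (v a) (TL top (v b))) (v c)"
      using v ab c(1) by (simp add: vhom_L_simps)
    then show "v ((a \<sqinter> vT A top b) \<squnion> c) = (if v \<in> \<Union>(insert V \<V>) then f v else bot)"
      using c(2)[OF v] eval_a[of v] v by (auto simp: TL_def V basic_open_def)
  qed
qed

lemma beta_image: "beta A ` vcarrier A = pbs_hom (Gobj A) L_pbs"
proof
  show "beta A ` vcarrier A \<subseteq> pbs_hom (Gobj A) L_pbs"
    using beta_in_pbs_hom by blast
  show "pbs_hom (Gobj A) L_pbs \<subseteq> beta A ` vcarrier A"
  proof
    fix f assume f: "f \<in> pbs_hom (Gobj A) L_pbs"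
    have "\<forall>U\<in>eval_patches f. openin (ptop1 (Gobj A)) U"
      using openin_basic_open by (auto simp: eval_patches_def)
    then obtain \<V> where \<V>: "finite \<V>" "\<V> \<subseteq> eval_patches f" "vhom A L_alg \<subseteq> \<Union>\<V>"
      using eval_patches_cover[OF f] stone_space_Gobj
      unfolding stone_space_def compact_space_alt pspace_Gobj by meson
    then obtain c where c: "c \<in> vcarrier A"
      "\<forall>v\<in>vhom A L_alg. v c = (if v \<in> \<Union>\<V> then f v else bot)"
      using ex_glued_patches by blast
    then have "v c = f v" if "v \<in> vhom A L_alg" for v
      using \<V>(3) that by (metis subsetD)
    moreover have "f \<in> extensional (vhom A L_alg)"
      using f by (simp add: pbs_hom_def pspace_Gobj PiE_iff)
    ultimately have "beta A c = f"
      using c(1) by (auto simp: beta_apply intro: extensionalityI)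
    then show "f \<in> beta A ` vcarrier A"
      using c(1) by blast
  qed
qed

end

lemma nontrivial_vl_algebraI:
  fixes A :: "('l::finite_distrib_lattice, 'a) vl_struct"
  assumes "(bot::'l) \<noteq> top" "vl_alg A"
  shows "nontrivial_vl_algebra A"
  using assms vl_algebraI by (simp add: nontrivial_vl_algebra_def nontrivial_vl_algebra_axioms_def)

section \<open>The algebra of a space\<close>

lemma Fobj_simps [simp]:
  "vcarrier (Fobj B) = pbs_hom B L_pbs"
  "vmeet (Fobj B) = (\<lambda>f g. \<lambda>s\<in>pspace B. inf (f s) (g s))"
  "vjoin (Fobj B) = (\<lambda>f g. \<lambda>s\<in>pspace B. sup (f s) (g s))"
  "vimp (Fobj B) = (\<lambda>f g. \<lambda>s\<in>pspace B. himpL (f s) (g s))"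
  "vT (Fobj B) = (\<lambda>p f. \<lambda>s\<in>pspace B. TL p (f s))"
  "vzero (Fobj B) = (\<lambda>s\<in>pspace B. bot)"
  "vone (Fobj B) = (\<lambda>s\<in>pspace B. top)"
  by (simp_all add: Fobj_def)

lemma restrict_eq_restrict_iff: "restrict f S = restrict g S \<longleftrightarrow> (\<forall>s\<in>S. f s = g s)"
  by (metis restrict_apply' restrict_ext)

lemma restrict_eq_iff_extensional:
  "g \<in> extensional S \<Longrightarrow> restrict f S = g \<longleftrightarrow> (\<forall>s\<in>S. f s = g s)"
  by (metis extensional_restrict restrict_eq_restrict_iff)

lemma pbs_hom_extensional: "f \<in> pbs_hom B D \<Longrightarrow> f \<in> extensional (pspace B)"
  by (simp add: pbs_hom_def PiE_iff)

lemma pbs_hom_in_pspace: "f \<in> pbs_hom B D \<Longrightarrow> s \<in> pspace B \<Longrightarrow> f s \<in> pspace D"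
  by (auto simp: pbs_hom_def)

lemma vle_Fobj_iff:
  "f \<in> extensional (pspace B) \<Longrightarrow> vle (Fobj B) f g \<longleftrightarrow> (\<forall>s\<in>pspace B. f s \<le> g s)"
  by (simp add: vle_def restrict_eq_iff_extensional inf.absorb_iff1)

lemma vBigJoin_Fobj: "vBigJoin (Fobj B) F = (\<lambda>s\<in>pspace B. vBigJoin L_alg (\<lambda>l. F l s))"
proof -
  have "foldr (vjoin (Fobj B)) (map F ls) (vzero (Fobj B)) =
      (\<lambda>s\<in>pspace B. foldr (vjoin L_alg) (map (\<lambda>l. F l s) ls) (vzero L_alg))" for ls
    by (induction ls) (auto intro!: restrict_ext)
  then show ?thesis
    by (simp add: vBigJoin_def)
qed

lemma vBigMeet_Fobj: "vBigMeet (Fobj B) F = (\<lambda>s\<in>pspace B. vBigMeet L_alg (\<lambda>l. F l s))"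
proof -
  have "foldr (vmeet (Fobj B)) (map F ls) (vone (Fobj B)) =
      (\<lambda>s\<in>pspace B. foldr (vmeet L_alg) (map (\<lambda>l. F l s) ls) (vone L_alg))" for ls
    by (induction ls) (auto intro!: restrict_ext)
  then show ?thesis
    by (simp add: vBigMeet_def)
qed

lemma zeta_apply: "s \<in> pspace B \<Longrightarrow> zeta B s = (\<lambda>\<psi>\<in>pbs_hom B L_pbs. \<psi> s)"
  by (simp add: zeta_def)

lemma (in vl_algebra) vhom_into_FobjI:
  assumes h: "h \<in> vcarrier A \<rightarrow>\<^sub>E pbs_hom B L_pbs"
    and pointwise: "\<And>s. s \<in> pspace B \<Longrightarrow> (\<lambda>a\<in>vcarrier A. h a s) \<in> vhom A L_alg"
  shows "h \<in> vhom A (Fobj B)"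
proof -
  have eq_if_eq_on: "h a = f"
    if "a \<in> vcarrier A" "f \<in> extensional (pspace B)" "\<And>s. s \<in> pspace B \<Longrightarrow> h a s = f s" for a f
    using that h by (auto intro!: extensionalityI[of _ "pspace B"] pbs_hom_extensional)
  show ?thesis
    unfolding vhom_def Fobj_simps
  proof (intro CollectI conjI ballI allI)
    show "h (vzero A) = (\<lambda>s\<in>pspace B. bot)" "h (vone A) = (\<lambda>s\<in>pspace B. top)"
      using vhom_L_simps(5,6)[OF pointwise] by (auto intro!: eq_if_eq_on)
    fix a assume a: "a \<in> vcarrier A"
    show "h (vT A l a) = (\<lambda>s\<in>pspace B. TL l (h a s))" for l
      using vhom_L_simps(4)[OF pointwise a] a by (auto intro!: eq_if_eq_on)
    fix b assume b: "b \<in> vcarrier A"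
    show "h (a \<sqinter> b) = (\<lambda>s\<in>pspace B. inf (h a s) (h b s))"
      "h (a \<squnion> b) = (\<lambda>s\<in>pspace B. sup (h a s) (h b s))"
      "h (a \<leadsto> b) = (\<lambda>s\<in>pspace B. himpL (h a s) (h b s))"
      using vhom_L_simps(1-3)[OF pointwise a b] a b by (auto intro!: eq_if_eq_on)
  qed (use h in simp)
qed

locale pbs_space =
  fixes B :: "('l::finite_distrib_lattice, 'b) pbs"
  assumes pbs_obj: "pbs_obj B"
begin

lemma ptop2_eq: "ptop2 B = ptop1 B" and stone_space_ptop1: "stone_space (ptop1 B)"
  using pbs_obj by (auto simp: pbs_obj_def pairwise_boolean_iff)

lemma closedin_palpha: "S \<in> SigmaL \<Longrightarrow> closedin (ptop1 B) (palpha B S)"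
  using pbs_obj by (auto simp: pbs_obj_def pairwise_closed_def)

lemma palpha_subset: "S \<in> SigmaL \<Longrightarrow> palpha B S \<subseteq> pspace B"
  using closedin_palpha closedin_subset by blast

lemma palpha_Inter:
  assumes "finite \<S>" "\<S> \<subseteq> SigmaL"
  shows "palpha B (\<Inter>\<S>) = pspace B \<inter> (\<Inter>S\<in>\<S>. palpha B S)"
  using assms
proof (induction rule: finite_induct)
  case empty
  show ?case
    using pbs_obj by (simp add: pbs_obj_def)
next
  case (insert S \<S>)
  then have "palpha B (S \<inter> \<Inter>\<S>) = palpha B S \<inter> palpha B (\<Inter>\<S>)"
    using pbs_obj SigmaL_Inter[of \<S>] by (simp add: pbs_obj_def)
  then show ?case
    using insert by auto
qed

lemma palpha_mono:
  assumes "S \<in> SigmaL" "T \<in> SigmaL" "S \<subseteq> T"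
  shows "palpha B S \<subseteq> palpha B T"
  using palpha_Inter[of "{S, T}"] assms by (auto simp: Int_absorb2)

lemma pbs_hom_L_iff:
  "f \<in> pbs_hom B L_pbs \<longleftrightarrow> f \<in> extensional (pspace B) \<and>
     continuous_map (ptop1 B) (discrete_topology UNIV) f \<and>
     (\<forall>S\<in>SigmaL. \<forall>s\<in>palpha B S. f s \<in> S)"
  by (auto simp: pbs_hom_def ptop2_eq PiE_iff)

lemma pbs_hom_L_compose2:
  assumes f: "f \<in> pbs_hom B L_pbs" and g: "g \<in> pbs_hom B L_pbs"
    and h: "\<And>S x y. S \<in> SigmaL \<Longrightarrow> x \<in> S \<Longrightarrow> y \<in> S \<Longrightarrow> h x y \<in> S"
  shows "(\<lambda>s\<in>pspace B. h (f s) (g s)) \<in> pbs_hom B L_pbs"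
proof -
  have "continuous_map (ptop1 B) (discrete_topology UNIV) (\<lambda>s. h (f s) (g s))"
    by (rule continuous_map_discrete_compose2) (use f g in \<open>simp_all add: pbs_hom_L_iff\<close>)
  moreover have "h (f s) (g s) \<in> S" if "S \<in> SigmaL" "s \<in> palpha B S" for S s
    using f g h that by (simp add: pbs_hom_L_iff)
  ultimately show ?thesis
    using palpha_subset by (auto simp: pbs_hom_L_iff)
qed

lemma Fobj_closed:
  "vzero (Fobj B) \<in> pbs_hom B L_pbs" "vone (Fobj B) \<in> pbs_hom B L_pbs"
  "f \<in> pbs_hom B L_pbs \<Longrightarrow> g \<in> pbs_hom B L_pbs \<Longrightarrow> vmeet (Fobj B) f g \<in> pbs_hom B L_pbs"
  "f \<in> pbs_hom B L_pbs \<Longrightarrow> g \<in> pbs_hom B L_pbs \<Longrightarrow> vjoin (Fobj B) f g \<in> pbs_hom B L_pbs"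
  "f \<in> pbs_hom B L_pbs \<Longrightarrow> g \<in> pbs_hom B L_pbs \<Longrightarrow> vimp (Fobj B) f g \<in> pbs_hom B L_pbs"
  "f \<in> pbs_hom B L_pbs \<Longrightarrow> vT (Fobj B) l f \<in> pbs_hom B L_pbs"
proof -
  show "vzero (Fobj B) \<in> pbs_hom B L_pbs" "vone (Fobj B) \<in> pbs_hom B L_pbs"
    using palpha_subset SigmaLD(1,2) by (auto simp: pbs_hom_L_iff)
  show "f \<in> pbs_hom B L_pbs \<Longrightarrow> vT (Fobj B) l f \<in> pbs_hom B L_pbs"
    using pbs_hom_L_compose2[of f f "\<lambda>x _. TL l x"] SigmaLD(3) by auto
  assume fg: "f \<in> pbs_hom B L_pbs" "g \<in> pbs_hom B L_pbs"
  show "vmeet (Fobj B) f g \<in> pbs_hom B L_pbs" "vjoin (Fobj B) f g \<in> pbs_hom B L_pbs"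
    "vimp (Fobj B) f g \<in> pbs_hom B L_pbs"
    using pbs_hom_L_compose2[OF fg, of inf] pbs_hom_L_compose2[OF fg, of sup]
      pbs_hom_L_compose2[OF fg, of himpL] SigmaLD(4-6) by auto
qed

lemma heyting_alg_Fobj: "heyting_alg (Fobj B)"
  unfolding heyting_alg_def Fobj_simps(1)
proof (intro conjI ballI)
  fix f g h assume "h \<in> pbs_hom B L_pbs"
  then show "vle (Fobj B) (vmeet (Fobj B) h f) g \<longleftrightarrow> vle (Fobj B) h (vimp (Fobj B) f g)"
    by (subst (1 2) vle_Fobj_iff) (auto simp: pbs_hom_extensional le_himpL_iff)
qed (use Fobj_closed in \<open>auto simp: restrict_eq_restrict_iff
    restrict_eq_iff_extensional[OF pbs_hom_extensional] inf.commute inf.left_commute inf.assoc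
    sup.commute sup.left_commute sup.assoc\<close>)

lemma vl_alg_Fobj: "vl_alg (Fobj B)"
proof -
  note L_axioms = vl_alg_L_alg[unfolded vl_alg_def, simplified]
  show ?thesis
    unfolding vl_alg_def
  proof (intro conjI ballI allI impI)
    show "heyting_alg (Fobj B)"
      by (rule heyting_alg_Fobj)
    show "vT (Fobj B) l f \<in> vcarrier (Fobj B)" if "f \<in> vcarrier (Fobj B)" for l f
      using that Fobj_closed(6) by (simp only: Fobj_simps(1))
  qed (use L_axioms in \<open>auto simp: vBigJoin_Fobj vBigMeet_Fobj vle_Fobj_iff viff_def
      restrict_eq_restrict_iff cong: restrict_cong\<close>)
qed

lemma zeta_in_vhom:
  assumes s: "s \<in> pspace B"
  shows "zeta B s \<in> vhom (Fobj B) L_alg"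
  unfolding vhom_def Fobj_simps(1)
  using Fobj_closed s by (simp add: zeta_apply)

definition least_subalg :: "'b \<Rightarrow> 'l set" where
  "least_subalg s = \<Inter>{S \<in> SigmaL. s \<in> palpha B S}"

lemma in_palpha_iff_least_subalg_subset:
  assumes S: "S \<in> SigmaL" and s: "s \<in> pspace B"
  shows "s \<in> palpha B S \<longleftrightarrow> least_subalg s \<subseteq> S"
proof
  show "least_subalg s \<subseteq> S" if "s \<in> palpha B S"
    using that S by (auto simp: least_subalg_def)
  have "least_subalg s \<in> SigmaL" "s \<in> palpha B (least_subalg s)"
    using palpha_Inter[OF finite, of "{S \<in> SigmaL. s \<in> palpha B S}"]
      SigmaL_Inter[of "{S \<in> SigmaL. s \<in> palpha B S}"] s
    by (auto simp: least_subalg_def)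
  then show "s \<in> palpha B S" if "least_subalg s \<subseteq> S"
    using palpha_mono[OF _ S that] by blast
qed

text \<open>The value \<open>l\<close> is admissible on a clopen neighbourhood of \<open>s\<close> avoiding the finitely many
  closed sets \<open>\<alpha>(S)\<close> with \<open>l \<notin> S\<close>.\<close>

lemma ex_pbs_hom_L_separating:
  assumes s: "s \<in> pspace B" and l: "l \<in> least_subalg s" and C: "closedin (ptop1 B) C" "s \<notin> C"
  shows "\<exists>f\<in>pbs_hom B L_pbs. f s = l \<and> (\<forall>t\<in>C. f t = bot)"
proof -
  define D where "D = C \<union> \<Union>(palpha B ` {S \<in> SigmaL. l \<notin> S})"
  have "closedin (ptop1 B) D" "s \<notin> D"
    using C l closedin_palpha unfolding D_def
    by (auto simp: least_subalg_def intro!: closedin_Un closedin_Union)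
  then obtain K where K: "openin (ptop1 B) K" "closedin (ptop1 B) K" "s \<in> K" "K \<inter> D = {}"
    using stone_space_clopen_avoiding[OF stone_space_ptop1] s by metis
  let ?f = "\<lambda>t\<in>pspace B. if t \<in> K then l else bot"
  have "?f \<in> pbs_hom B L_pbs"
    unfolding pbs_hom_L_iff
  proof (intro conjI ballI)
    show "continuous_map (ptop1 B) (discrete_topology UNIV) ?f"
      using continuous_map_discrete_step[OF K(1,2)] by simp
    show "?f t \<in> S" if "S \<in> SigmaL" "t \<in> palpha B S" for S t
      using that K(4) palpha_subset SigmaLD(1) by (auto simp: D_def)
  qed simp
  moreover have "?f s = l" "\<forall>t\<in>C. ?f t = bot"
    using s K(3,4) closedin_subset[OF C(1)] by (auto simp: D_def)
  ultimately show ?thesis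
    by blast
qed

lemma zeta_image_carrier:
  assumes s: "s \<in> pspace B"
  shows "zeta B s ` pbs_hom B L_pbs = least_subalg s"
proof
  show "zeta B s ` pbs_hom B L_pbs \<subseteq> least_subalg s"
    using s by (auto simp: zeta_apply least_subalg_def pbs_hom_L_iff)
  show "least_subalg s \<subseteq> zeta B s ` pbs_hom B L_pbs"
    using ex_pbs_hom_L_separating[OF s _ closedin_empty] s by (fastforce simp: zeta_apply)
qed

lemma zeta_in_palpha_iff:
  "S \<in> SigmaL \<Longrightarrow> s \<in> pspace B \<Longrightarrow> zeta B s \<in> palpha (Gobj (Fobj B)) S \<longleftrightarrow> s \<in> palpha B S"
  by (simp add: palpha_Gobj zeta_in_vhom zeta_image_carrier in_palpha_iff_least_subalg_subset)

lemma pbs_hom_compose: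
  assumes \<phi>: "\<phi> \<in> pbs_hom B D" and \<psi>: "\<psi> \<in> pbs_hom D E"
  shows "compose (pspace B) \<psi> \<phi> \<in> pbs_hom B E"
proof -
  have "continuous_map (ptop1 B) (ptop1 E) (\<psi> \<circ> \<phi>)" "continuous_map (ptop2 B) (ptop2 E) (\<psi> \<circ> \<phi>)"
    using \<phi> \<psi> by (auto simp: pbs_hom_def intro: continuous_map_compose)
  moreover have "\<psi> (\<phi> s) \<in> palpha E S" if "S \<in> SigmaL" "s \<in> palpha B S" for S s
    using that \<phi> \<psi> by (force simp: pbs_hom_def)
  ultimately show ?thesis
    using pbs_hom_in_pspace[OF \<phi>] pbs_hom_in_pspace[OF \<psi>]
    by (auto simp: pbs_hom_def compose_def comp_def ptop2_eq dest: subsetD[OF palpha_subset])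
qed

lemma pbs_hom_inverse:
  assumes D: "pbs_obj D" and homeo: "homeomorphic_map (ptop1 B) (ptop1 D) f"
    and palpha_D: "\<And>S. S \<in> SigmaL \<Longrightarrow> palpha D S \<subseteq> f ` palpha B S"
  shows "\<exists>\<theta>\<in>pbs_hom D B. (\<forall>s\<in>pspace B. \<theta> (f s) = s) \<and> (\<forall>y\<in>pspace D. f (\<theta> y) = y)"
proof -
  interpret D: pbs_space D
    using D by (rule pbs_space.intro)
  obtain g where g: "continuous_map (ptop1 D) (ptop1 B) g"
    and gf: "\<And>s. s \<in> pspace B \<Longrightarrow> g (f s) = s" and fg: "\<And>y. y \<in> pspace D \<Longrightarrow> f (g y) = y"
    using homeo unfolding homeomorphic_map_maps homeomorphic_maps_def by blast
  have f_in: "f s \<in> pspace D" if "s \<in> pspace B" for s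
    using homeomorphic_imp_surjective_map[OF homeo] that by blast
  have "g y \<in> palpha B S" if S: "S \<in> SigmaL" and y: "y \<in> palpha D S" for S y
  proof -
    obtain s where "s \<in> palpha B S" "y = f s"
      using palpha_D[OF S] y by blast
    then show ?thesis
      using gf palpha_subset[OF S] by auto
  qed
  then have "restrict g (pspace D) \<in> pbs_hom D B"
    using g D.palpha_subset continuous_map_funspace[OF g]
    by (auto simp: pbs_hom_def ptop2_eq D.ptop2_eq)
  then show ?thesis
    using gf fg f_in by (intro bexI[of _ "restrict g (pspace D)"]) auto
qed

end

locale nontrivial_pbs_space = pbs_space B
  for B :: "('l::finite_distrib_lattice, 'b) pbs" +
  assumes bot_neq_top: "(bot::'l) \<noteq> top"
begin

sublocale F: nontrivial_vl_algebra "Fobj B"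
  using bot_neq_top vl_alg_Fobj by (rule nontrivial_vl_algebraI)

lemma inj_on_zeta: "inj_on (zeta B) (pspace B)"
proof (rule inj_onI, rule ccontr)
  fix s t assume st: "s \<in> pspace B" "t \<in> pspace B" "zeta B s = zeta B t" "s \<noteq> t"
  have "closedin (ptop1 B) {t}"
    using stone_space_ptop1 st(2) unfolding stone_space_def
    by (simp add: closedin_Hausdorff_sing_eq)
  moreover have "top \<in> least_subalg s"
    by (auto simp: least_subalg_def SigmaLD)
  ultimately obtain f where "f \<in> pbs_hom B L_pbs" "f s = top" "f t = bot"
    using ex_pbs_hom_L_separating[OF st(1)] st(4) by blast
  then show False
    using fun_cong[OF st(3), of f] st(1,2) bot_neq_top by (simp add: zeta_apply)
qed

lemma continuous_map_zeta: "continuous_map (ptop1 B) (ptop1 (Gobj (Fobj B))) (zeta B)"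
  unfolding F.continuous_map_into_Gobj_iff
proof (intro conjI ballI)
  show "zeta B \<in> pspace B \<rightarrow> vhom (Fobj B) L_alg"
    using zeta_in_vhom by blast
  fix \<psi> assume "\<psi> \<in> vcarrier (Fobj B)"
  then have \<psi>: "\<psi> \<in> pbs_hom B L_pbs"
    by simp
  then have "continuous_map (ptop1 B) (discrete_topology UNIV) \<psi>"
    by (simp add: pbs_hom_L_iff)
  then show "continuous_map (ptop1 B) (discrete_topology UNIV) (\<lambda>s. zeta B s \<psi>)"
    by (rule continuous_map_eq) (simp add: \<psi> zeta_apply)
qed

lemma zeta_dense:
  assumes \<psi>: "\<psi> \<in> pbs_hom B L_pbs" and v: "v \<in> basic_open (Fobj B) \<psi>"
  shows "\<exists>s\<in>pspace B. zeta B s \<in> basic_open (Fobj B) \<psi>"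
proof (rule ccontr)
  assume "\<not> ?thesis"
  then have "\<psi> s \<noteq> top" if "s \<in> pspace B" for s
    using that zeta_in_vhom \<psi> by (auto simp: basic_open_def zeta_apply)
  then have T_top_eq: "vT (Fobj B) top \<psi> = vzero (Fobj B)"
    by (simp add: restrict_eq_restrict_iff TL_def)
  have v_hom: "v \<in> vhom (Fobj B) L_alg" and "v \<psi> = top"
    using v by (simp_all add: basic_open_def)
  then have "top = v (vT (Fobj B) top \<psi>)"
    using vhom_L_simps(4)[OF v_hom, of \<psi> top] \<psi> by (simp add: TL_def)
  also have "\<dots> = v (vzero (Fobj B))"
    by (simp only: T_top_eq)
  also have "\<dots> = bot"
    by (rule vhom_L_simps(5)[OF v_hom])
  finally show False
    using bot_neq_top by simp
qed

lemma zeta_image: "zeta B ` pspace B = pspace (Gobj (Fobj B))"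
proof
  show "zeta B ` pspace B \<subseteq> pspace (Gobj (Fobj B))"
    using zeta_in_vhom by (auto simp: F.pspace_Gobj)
  have "compactin (ptop1 (Gobj (Fobj B))) (zeta B ` pspace B)"
    using stone_space_ptop1 continuous_map_zeta image_compactin
    unfolding stone_space_def compact_space_def by blast
  then have "closedin (ptop1 (Gobj (Fobj B))) (zeta B ` pspace B)"
    using F.stone_space_Gobj compactin_imp_closedin unfolding stone_space_def by blast
  then have "openin (ptop1 (Gobj (Fobj B))) (pspace (Gobj (Fobj B)) - zeta B ` pspace B)"
    by blast
  then show "pspace (Gobj (Fobj B)) \<subseteq> zeta B ` pspace B"
    using F.ex_basic_open_subset zeta_dense by fastforce
qed

lemma homeomorphic_map_zeta: "homeomorphic_map (ptop1 B) (ptop1 (Gobj (Fobj B))) (zeta B)"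
  using continuous_imp_homeomorphic_map[OF continuous_map_zeta _ _ zeta_image inj_on_zeta]
    stone_space_ptop1 F.stone_space_Gobj by (simp add: stone_space_def)

lemma zeta_image_palpha:
  assumes S: "S \<in> SigmaL"
  shows "zeta B ` palpha B S = palpha (Gobj (Fobj B)) S"
proof -
  have "palpha (Gobj (Fobj B)) S \<subseteq> zeta B ` pspace B"
    unfolding zeta_image by (auto simp: palpha_Gobj F.pspace_Gobj)
  then show ?thesis
    using zeta_in_palpha_iff[OF S] palpha_subset[OF S] by blast
qed

lemma zeta_in_pbs_hom: "zeta B \<in> pbs_hom B (Gobj (Fobj B))"
proof -
  have "zeta B \<in> pspace B \<rightarrow>\<^sub>E pspace (Gobj (Fobj B))"
    using zeta_image by (auto simp: PiE_iff zeta_def)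
  then show ?thesis
    using continuous_map_zeta zeta_image_palpha
    by (simp add: pbs_hom_def ptop2_eq F.ptop2_Gobj)
qed

lemma zeta_iso:
  "zeta B \<in> pbs_hom B (Gobj (Fobj B))"
  "bij_betw (zeta B) (pspace B) (pspace (Gobj (Fobj B)))"
  "homeomorphic_map (ptop1 B) (ptop1 (Gobj (Fobj B))) (zeta B)"
  "homeomorphic_map (ptop2 B) (ptop2 (Gobj (Fobj B))) (zeta B)"
  "\<exists>\<theta>\<in>pbs_hom (Gobj (Fobj B)) B.
     (\<forall>s\<in>pspace B. \<theta> (zeta B s) = s) \<and> (\<forall>y\<in>pspace (Gobj (Fobj B)). zeta B (\<theta> y) = y)"
  using zeta_in_pbs_hom homeomorphic_map_zeta inj_on_zeta zeta_image
    pbs_hom_inverse[OF F.pbs_obj_Gobj homeomorphic_map_zeta] zeta_image_palpha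
  by (simp_all add: bij_betw_def ptop2_eq F.ptop2_Gobj)

end

lemma nontrivial_pbs_spaceI:
  fixes B :: "('l::finite_distrib_lattice, 'b) pbs"
  assumes "(bot::'l) \<noteq> top" "pbs_obj B"
  shows "nontrivial_pbs_space B"
  using assms by unfold_locales

section \<open>Functoriality and naturality\<close>

lemma Gmor_eq_compose: "\<mu> \<in> vhom C L_alg \<Longrightarrow> Gmor A C g \<mu> = compose (vcarrier A) \<mu> g"
  by (simp add: Gmor_def compose_def)

lemma Fmor_eq_compose: "\<eta> \<in> pbs_hom D L_pbs \<Longrightarrow> Fmor B D \<phi> \<eta> = compose (pspace B) \<eta> \<phi>"
  by (simp add: Fmor_def compose_def)

lemma Gmor_id:
  assumes "\<mu> \<in> pspace (Gobj A)"
  shows "Gmor A A (\<lambda>x\<in>vcarrier A. x) \<mu> = \<mu>"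
  using pspace_GobjD[OF assms] vhomD(1)[of \<mu> A]
  by (simp add: Gmor_eq_compose compose_Id[of _ _ UNIV])

lemma Fmor_id:
  assumes "\<eta> \<in> vcarrier (Fobj B)"
  shows "Fmor B B (\<lambda>x\<in>pspace B. x) \<eta> = \<eta>"
  using assms pbs_hom_extensional[of \<eta> B] by (simp add: Fmor_eq_compose compose_Id[of _ _ UNIV])

lemma Gmor_compose:
  assumes C: "vl_alg C" and g: "g \<in> vhom A C" and h: "h \<in> vhom C E"
    and \<mu>: "\<mu> \<in> pspace (Gobj E)"
  shows "Gmor A E (compose (vcarrier A) h g) \<mu> = Gmor A C g (Gmor C E h \<mu>)"
proof -
  interpret C: vl_algebra C
    using C by (rule vl_algebraI)
  have "g \<in> vcarrier A \<rightarrow> vcarrier C"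
    using vhomD(2)[OF g] by blast
  then show ?thesis
    using pspace_GobjD[OF \<mu>] C.vhom_compose[OF h pspace_GobjD[OF \<mu>]]
    by (simp add: Gmor_eq_compose compose_assoc)
qed

lemma Fmor_compose:
  assumes D: "pbs_obj D" and \<phi>: "\<phi> \<in> pbs_hom B D" and \<psi>: "\<psi> \<in> pbs_hom D E"
    and \<eta>: "\<eta> \<in> vcarrier (Fobj E)"
  shows "Fmor B E (compose (pspace B) \<psi> \<phi>) \<eta> = Fmor B D \<phi> (Fmor D E \<psi> \<eta>)"
proof -
  interpret D: pbs_space D
    using D by (rule pbs_space.intro)
  have "\<phi> \<in> pspace B \<rightarrow> pspace D"
    using pbs_hom_in_pspace[OF \<phi>] by blast
  then show ?thesis
    using \<eta> D.pbs_hom_compose[OF \<psi>, of \<eta> L_pbs] by (simp add: Fmor_eq_compose compose_assoc)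
qed

lemma zeta_natural:
  assumes B: "pbs_obj B" and \<phi>: "\<phi> \<in> pbs_hom B D" and s: "s \<in> pspace B"
  shows "Gmor (Fobj D) (Fobj B) (Fmor B D \<phi>) (zeta B s) = zeta D (\<phi> s)"
proof -
  interpret B: pbs_space B
    using B by (rule pbs_space.intro)
  show ?thesis
    using B.zeta_in_vhom[OF s] B.pbs_hom_compose[OF \<phi>, of _ L_pbs] pbs_hom_in_pspace[OF \<phi> s] s
    by (simp add: Gmor_eq_compose zeta_apply Fmor_eq_compose compose_def cong: restrict_cong)
qed

lemma Fmor_in_vhom:
  assumes B: "pbs_obj B" and D: "pbs_obj D" and \<phi>: "\<phi> \<in> pbs_hom B D"
  shows "Fmor B D \<phi> \<in> vhom (Fobj D) (Fobj B)"
proof -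
  interpret B: pbs_space B
    using B by (rule pbs_space.intro)
  interpret D: pbs_space D
    using D by (rule pbs_space.intro)
  interpret FD: vl_algebra "Fobj D"
    using D.vl_alg_Fobj by (rule vl_algebraI)
  show ?thesis
  proof (rule FD.vhom_into_FobjI)
    show "Fmor B D \<phi> \<in> vcarrier (Fobj D) \<rightarrow>\<^sub>E pbs_hom B L_pbs"
      using B.pbs_hom_compose[OF \<phi>, of _ L_pbs] by (auto simp: Fmor_eq_compose) (simp add: Fmor_def)
    fix s assume s: "s \<in> pspace B"
    have "(\<lambda>\<eta>\<in>vcarrier (Fobj D). Fmor B D \<phi> \<eta> s) = zeta D (\<phi> s)"
      using pbs_hom_in_pspace[OF \<phi> s] s
      by (simp add: zeta_apply Fmor_eq_compose compose_eq cong: restrict_cong)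
    then show "(\<lambda>\<eta>\<in>vcarrier (Fobj D). Fmor B D \<phi> \<eta> s) \<in> vhom (Fobj D) L_alg"
      using D.zeta_in_vhom pbs_hom_in_pspace[OF \<phi> s] by simp
  qed
qed

lemma (in nontrivial_vl_algebra) Gmor_in_pbs_hom:
  assumes C: "vl_alg C" and g: "g \<in> vhom A C"
  shows "Gmor A C g \<in> pbs_hom (Gobj C) (Gobj A)"
proof -
  interpret C: nontrivial_vl_algebra C
    using bot_neq_top C by (rule nontrivial_vl_algebraI)
  have in_vhom: "Gmor A C g \<mu> \<in> vhom A L_alg" if "\<mu> \<in> vhom C L_alg" for \<mu>
    using vhom_compose[OF g that] that by (simp add: Gmor_eq_compose)
  have Gmor_eval: "Gmor A C g \<mu> a = \<mu> (g a)" if "\<mu> \<in> vhom C L_alg" "a \<in> vcarrier A" for \<mu> a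
    using that by (simp add: Gmor_eq_compose compose_eq)
  have "continuous_map (ptop1 (Gobj C)) (ptop1 (Gobj A)) (Gmor A C g)"
    unfolding continuous_map_into_Gobj_iff
  proof (intro conjI ballI)
    show "continuous_map (ptop1 (Gobj C)) (discrete_topology UNIV) (\<lambda>\<mu>. Gmor A C g \<mu> a)"
      if a: "a \<in> vcarrier A" for a
      using a C.continuous_map_eval[OF vhomD(2)[OF g a]]
      by (auto simp: Gmor_eval C.pspace_Gobj elim: continuous_map_eq)
  qed (use in_vhom in \<open>simp add: C.pspace_Gobj\<close>)
  moreover have "Gmor A C g \<mu> \<in> palpha (Gobj A) S" if "\<mu> \<in> palpha (Gobj C) S" for \<mu> S
    using that in_vhom vhomD(2)[OF g] by (auto simp: palpha_Gobj Gmor_eval)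
  moreover have "Gmor A C g \<in> extensional (vhom C L_alg)"
    by (simp add: Gmor_def)
  ultimately show ?thesis
    using in_vhom
    by (auto simp: pbs_hom_def PiE_iff ptop2_Gobj C.ptop2_Gobj pspace_Gobj C.pspace_Gobj)
qed

lemma (in nontrivial_vl_algebra) beta_iso:
  "beta A \<in> vhom A (Fobj (Gobj A))"
  "bij_betw (beta A) (vcarrier A) (vcarrier (Fobj (Gobj A)))"
proof -
  show "beta A \<in> vhom A (Fobj (Gobj A))"
  proof (rule vhom_into_FobjI)
    show "beta A \<in> vcarrier A \<rightarrow>\<^sub>E pbs_hom (Gobj A) L_pbs"
      using beta_in_pbs_hom by (auto simp: beta_def)
    fix v assume "v \<in> pspace (Gobj A)"
    then have v: "v \<in> vhom A L_alg"
      by (simp add: pspace_Gobj)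
    have "(\<lambda>a\<in>vcarrier A. beta A a v) = v"
      using v vhomD(1)[OF v] by (simp add: restrict_eq_iff_extensional beta_apply)
    then show "(\<lambda>a\<in>vcarrier A. beta A a v) \<in> vhom A L_alg"
      using v by simp
  qed
  show "bij_betw (beta A) (vcarrier A) (vcarrier (Fobj (Gobj A)))"
    by (simp add: bij_betw_def inj_on_beta beta_image)
qed

lemma (in nontrivial_vl_algebra) beta_natural:
  assumes C: "vl_alg C" and g: "g \<in> vhom A C" and a: "a \<in> vcarrier A"
  shows "Fmor (Gobj C) (Gobj A) (Gmor A C g) (beta A a) = beta C (g a)"
proof -
  interpret C: nontrivial_vl_algebra C
    using bot_neq_top C by (rule nontrivial_vl_algebraI)
  show ?thesis
    using beta_in_pbs_hom[OF a] vhomD(2)[OF g a] vhom_compose[OF g, of _ L_alg] a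
    by (simp add: Fmor_eq_compose C.pspace_Gobj beta_apply Gmor_eq_compose compose_def
        cong: restrict_cong)
qed

theorem theorem1:
  assumes nontriv: "(bot::'l::finite_distrib_lattice) \<noteq> top"
  shows
  "\<comment> \<open>G is a functor VA_L \<rightarrow> PBS_L (contravariant)\<close>
   (\<forall>A :: ('l, 'a) vl_struct. vl_alg A \<longrightarrow> pbs_obj (Gobj A)) \<and>
   (\<forall>(A :: ('l, 'a) vl_struct) (C :: ('l, 'c) vl_struct) g.
      vl_alg A \<and> vl_alg C \<and> g \<in> vhom A C \<longrightarrow> Gmor A C g \<in> pbs_hom (Gobj C) (Gobj A)) \<and>
   (\<forall>A :: ('l, 'a) vl_struct. vl_alg A \<longrightarrow>
      (\<forall>\<mu>\<in>pspace (Gobj A). Gmor A A (\<lambda>x\<in>vcarrier A. x) \<mu> = \<mu>)) \<and>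
   (\<forall>(A :: ('l, 'a) vl_struct) (C :: ('l, 'c) vl_struct) (E :: ('l, 'e) vl_struct) g h.
      vl_alg A \<and> vl_alg C \<and> vl_alg E \<and> g \<in> vhom A C \<and> h \<in> vhom C E \<longrightarrow>
      (\<forall>\<mu>\<in>pspace (Gobj E).
         Gmor A E (compose (vcarrier A) h g) \<mu> = Gmor A C g (Gmor C E h \<mu>))) \<and>
   \<comment> \<open>F is a functor PBS_L \<rightarrow> VA_L (contravariant)\<close>
   (\<forall>B :: ('l, 'b) pbs. pbs_obj B \<longrightarrow> vl_alg (Fobj B)) \<and>
   (\<forall>(B :: ('l, 'b) pbs) (D :: ('l, 'd) pbs) \<phi>.
      pbs_obj B \<and> pbs_obj D \<and> \<phi> \<in> pbs_hom B D \<longrightarrow> Fmor B D \<phi> \<in> vhom (Fobj D) (Fobj B)) \<and>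
   (\<forall>B :: ('l, 'b) pbs. pbs_obj B \<longrightarrow>
      (\<forall>\<eta>\<in>vcarrier (Fobj B). Fmor B B (\<lambda>x\<in>pspace B. x) \<eta> = \<eta>)) \<and>
   (\<forall>(B :: ('l, 'b) pbs) (D :: ('l, 'd) pbs) (E :: ('l, 'f) pbs) \<phi> \<psi>.
      pbs_obj B \<and> pbs_obj D \<and> pbs_obj E \<and> \<phi> \<in> pbs_hom B D \<and> \<psi> \<in> pbs_hom D E \<longrightarrow>
      (\<forall>\<eta>\<in>vcarrier (Fobj E).
         Fmor B E (compose (pspace B) \<psi> \<phi>) \<eta> = Fmor B D \<phi> (Fmor D E \<psi> \<eta>))) \<and>
   \<comment> \<open>beta is a natural isomorphism Id \<rightarrow> F G\<close>
   (\<forall>A :: ('l, 'a) vl_struct. vl_alg A \<longrightarrow>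
      beta A \<in> vhom A (Fobj (Gobj A)) \<and>
      bij_betw (beta A) (vcarrier A) (vcarrier (Fobj (Gobj A)))) \<and>
   (\<forall>(A :: ('l, 'a) vl_struct) (C :: ('l, 'c) vl_struct) g.
      vl_alg A \<and> vl_alg C \<and> g \<in> vhom A C \<longrightarrow>
      (\<forall>a\<in>vcarrier A. Fmor (Gobj C) (Gobj A) (Gmor A C g) (beta A a) = beta C (g a))) \<and>
   \<comment> \<open>zeta is a natural isomorphism Id \<rightarrow> G F, a bi-homeomorphism\<close>
   (\<forall>B :: ('l, 'b) pbs. pbs_obj B \<longrightarrow>
      zeta B \<in> pbs_hom B (Gobj (Fobj B)) \<and>
      bij_betw (zeta B) (pspace B) (pspace (Gobj (Fobj B))) \<and>
      homeomorphic_map (ptop1 B) (ptop1 (Gobj (Fobj B))) (zeta B) \<and>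
      homeomorphic_map (ptop2 B) (ptop2 (Gobj (Fobj B))) (zeta B) \<and>
      (\<exists>\<theta>\<in>pbs_hom (Gobj (Fobj B)) B.
         (\<forall>s\<in>pspace B. \<theta> (zeta B s) = s) \<and>
         (\<forall>y\<in>pspace (Gobj (Fobj B)). zeta B (\<theta> y) = y))) \<and>
   (\<forall>(B :: ('l, 'b) pbs) (D :: ('l, 'd) pbs) \<phi>.
      pbs_obj B \<and> pbs_obj D \<and> \<phi> \<in> pbs_hom B D \<longrightarrow>
      (\<forall>s\<in>pspace B. Gmor (Fobj D) (Fobj B) (Fmor B D \<phi>) (zeta B s) = zeta D (\<phi> s)))"
proof -
  note algebra = nontrivial_vl_algebraI[OF nontriv] and space = nontrivial_pbs_spaceI[OF nontriv]
  note G_functor = nontrivial_vl_algebra.pbs_obj_Gobj[OF algebra]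
    nontrivial_vl_algebra.Gmor_in_pbs_hom[OF algebra] Gmor_id Gmor_compose
  note F_functor = pbs_space.vl_alg_Fobj[OF pbs_space.intro] Fmor_in_vhom Fmor_id Fmor_compose
  note beta_natural_iso = nontrivial_vl_algebra.beta_iso[OF algebra]
    nontrivial_vl_algebra.beta_natural[OF algebra]
  note zeta_natural_iso = nontrivial_pbs_space.zeta_iso[OF space] zeta_natural
  show ?thesis
    by (intro conjI allI impI ballI; (elim conjE)?;
        rule G_functor F_functor beta_natural_iso zeta_natural_iso; assumption)
qed

end
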